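(* Let $k$ be a field of characteristic zero, let $A$ be the Grossman-Larson Hopf algebra of rooted trees over $k$, with unit $e$ (the one-vertex tree) and counit $\varepsilon$, and let $A^0$ be its finite dual Hopf algebra. Let $N(e)$ denote the rooted tree with two vertices, let $M:A\to A$ be the $k$-linear map with $M(e)=0$ and $M(t)=tN(e)$ (product in $A$) for all rooted trees $t\neq e$, and let $M^*:A^*\to A^*$, $M^*(f)=f\circ M$, be its transpose. Then $M^*(A^0)\subseteq A^0$, and the restriction $M^0$ of $M^*$ to $A^0$ is a solution of the Hochschild equation on $A^0$, that is, for all $f\in A^0$, $$\Delta(M^0(f))=M^0(f)\otimes\varepsilon+(\mathrm{id}\otimes M^0)(\Delta(f)),$$ where $\Delta$ is the comultiplication of $A^0$.
   Context: All algebras, linear spaces and tensor products are over $k$. A rooted tree is a finite, connected and simply-connected set of oriented edges and vertices with exactly one distinguished vertex with no incoming edges, the root; edges are oriented away from the root, and trees are considered up to isomorphism (no ordering of children, no labels). The children of a vertex $v$ are the endpoints of the edges outgoing from $v$. All trees are non-empty; $e$ denotes the rooted tree with only one vertex. The Hopf algebra $A$: as a vector space it has a basis consisting of all rooted trees. The unit is $e$. Product: for rooted trees $t_1,t_2$, let $s_1,\dots,s_r$ be the children of the root of $t_1$ and $n$ the number of vertices of $t_2$; there are $n^r$ ways to attach the $r$ subtrees of $t_1$ with roots $s_1,\dots,s_r$ to $t_2$ by making each $s_i$ a child of some vertex of $t_2$ (the root of the result being the root of $t_2$); $t_1t_2$ is the sum of these $n^r$ rooted trees (with multiplicity). Coproduct: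 if $t$ is a rooted tree whose root has children $s_1,\dots,s_r$, then $\Delta(t)$ is the sum of the $2^r$ terms $t_1\otimes t_2$, where the children of the root of $t_1$ and the children of the root of $t_2$ (together with the subtrees they carry) range over all $2^r$ ordered partitions of $\{s_1,\dots,s_r\}$ into two (possibly empty) subsets; $\Delta(e)=e\otimes e$. Counit: $\varepsilon(e)=1$, $\varepsilon(t)=0$ for $t\neq e$. It is known that $A$ is a graded connected cocommutative Hopf algebra. Finite dual: $A^0$ is the set of $f\in A^*$ such that $\mathrm{Ker}(f)$ contains a cofinite (finite-codimensional two-sided) ideal of $A$. With $m$ the multiplication of $A$, $f\in A^*$ lies in $A^0$ if and only if $m^*(f)\in A^*\otimes A^*$, i.e. there are finitely many $f_i,f_i'\in A^*$ with $f(ab)=\sum_i f_i(a)f_i'(b)$ for all $a,b\in A$. $A^0$ is a Hopf algebra whose comultiplication is the restriction of $m^*$ (with $m^*(A^0)\subseteq A^0\otimes A^0$), whose product is dual to the coproduct of $A$, and whose unit is $\varepsilon$. For a Hopf algebra $H$, a linear map $L:H\to H$ satisfies the Hochschild equation if $\Delta(L(h))=L(h)\otimes 1+(\mathrm{id}\otimes L)(\Delta(h))$ for all $h\in H$. *)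

theory Defs
  imports Complex_Main "HOL-Library.Multiset" "HOL-Library.FuncSet" "HOL-Library.Poly_Mapping"
    "HOL-Library.Function_Algebras"
begin

section \<open>Rooted trees\<close>

text \<open>
  An isomorphism class of rooted trees is determined by the multiset of isomorphism classes of
  the subtrees carried by the children of the root.
\<close>

datatype rtree = Node "rtree multiset"

definition e_tree :: rtree where
  "e_tree = Node {#}"

definition N_e :: rtree where
  "N_e = Node {#e_tree#}"

text \<open>
  To speak about individual vertices of a tree we need a concrete representative of its
  isomorphism class: a tree with pairwise distinct names on the vertices.
\<close>

datatype 'v ltree = LNode 'v "'v ltree multiset"

primrec lchildren :: "'v ltree \<Rightarrow> 'v ltree multiset" where
  "lchildren (LNode v C) = C"

primrec shape :: "'v ltree \<Rightarrow> rtree" where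
  "shape (LNode v C) = Node (image_mset shape C)"

primrec vertex_mset :: "'v ltree \<Rightarrow> 'v multiset" where
  "vertex_mset (LNode v C) = add_mset v (\<Sum>\<^sub># (image_mset vertex_mset C))"

definition vertices :: "'v ltree \<Rightarrow> 'v set" where
  "vertices l = set_mset (vertex_mset l)"

definition distinct_names :: "'v ltree \<Rightarrow> bool" where
  "distinct_names l \<longleftrightarrow> (\<forall>v. count (vertex_mset l) v \<le> 1)"

definition represents :: "nat ltree \<Rightarrow> rtree \<Rightarrow> bool" where
  "represents l t \<longleftrightarrow> distinct_names l \<and> shape l = t"

definition named :: "rtree \<Rightarrow> nat ltree" where
  "named t = (SOME l. represents l t)"

text \<open>
  Since the names are distinct, the multiset of children of a vertex of \<^term>\<open>named t\<close> has no
  repetitions and may be used as a set.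
\<close>

definition root_children :: "rtree \<Rightarrow> nat ltree set" where
  "root_children t = set_mset (lchildren (named t))"

text \<open>\<open>graft g l\<close> attaches the trees in \<open>g v\<close> as additional children to every vertex \<open>v\<close> of \<open>l\<close>.\<close>

primrec graft :: "('v \<Rightarrow> rtree multiset) \<Rightarrow> 'v ltree \<Rightarrow> rtree" where
  "graft g (LNode v C) = Node (g v + image_mset (graft g) C)"

definition subtrees_of :: "nat ltree set \<Rightarrow> rtree multiset" where
  "subtrees_of S = image_mset shape (mset_set S)"

section \<open>The Grossman-Larson Hopf algebra\<close>

text \<open>
  \<open>A\<close> is the vector space \<open>rtree \<Rightarrow>\<^sub>0 'k\<close> with basis the rooted trees, and \<open>A \<otimes> A\<close> is the vector
  space \<open>rtree \<times> rtree \<Rightarrow>\<^sub>0 'k\<close> with basis the pairs of rooted trees. The class instance of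
  multiplication on \<open>\<Rightarrow>\<^sub>0\<close> in the library is a different one and plays no role here.
\<close>

type_synonym 'k gl = "rtree \<Rightarrow>\<^sub>0 'k"
type_synonym 'k gl2 = "(rtree \<times> rtree) \<Rightarrow>\<^sub>0 'k"

definition scale :: "'k::field \<Rightarrow> ('b \<Rightarrow>\<^sub>0 'k) \<Rightarrow> ('b \<Rightarrow>\<^sub>0 'k)" where
  "scale c a = Poly_Mapping.map ((*) c) a"

definition basis :: "'b \<Rightarrow> ('b \<Rightarrow>\<^sub>0 'k::field)" where
  "basis t = Poly_Mapping.single t 1"

definition lin_ext :: "('b \<Rightarrow> ('c \<Rightarrow>\<^sub>0 'k)) \<Rightarrow> ('b \<Rightarrow>\<^sub>0 'k::field) \<Rightarrow> ('c \<Rightarrow>\<^sub>0 'k)" where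
  "lin_ext F a = (\<Sum>t\<in>Poly_Mapping.keys a. scale (Poly_Mapping.lookup a t) (F t))"

definition tensor :: "'k::field gl \<Rightarrow> 'k gl \<Rightarrow> 'k gl2" where
  "tensor a b = (\<Sum>s\<in>Poly_Mapping.keys a. \<Sum>t\<in>Poly_Mapping.keys b.
     scale (Poly_Mapping.lookup a s * Poly_Mapping.lookup b t) (basis (s, t)))"

definition gl_unit :: "'k::field gl" where
  "gl_unit = basis e_tree"

definition tree_mult :: "rtree \<Rightarrow> rtree \<Rightarrow> 'k::field gl" where
  "tree_mult t1 t2 =
     (\<Sum>\<phi>\<in>root_children t1 \<rightarrow>\<^sub>E vertices (named t2).
        basis (graft (\<lambda>v. subtrees_of {s \<in> root_children t1. \<phi> s = v}) (named t2)))"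

definition gl_mult_map :: "'k::field gl2 \<Rightarrow> 'k gl" where
  "gl_mult_map = lin_ext (\<lambda>(t1, t2). tree_mult t1 t2)"

definition gl_mult :: "'k::field gl \<Rightarrow> 'k gl \<Rightarrow> 'k gl" where
  "gl_mult a b = gl_mult_map (tensor a b)"

definition gl_comult :: "'k::field gl \<Rightarrow> 'k gl2" where
  "gl_comult = lin_ext (\<lambda>t. \<Sum>S\<in>Pow (root_children t).
     basis (Node (subtrees_of S), Node (subtrees_of (root_children t - S))))"

definition gl_counit :: "'k::field gl \<Rightarrow> 'k" where
  "gl_counit a = Poly_Mapping.lookup a e_tree"

section \<open>The finite dual\<close>

definition dual :: "('k::field gl \<Rightarrow> 'k) set" where
  "dual = {f. Vector_Spaces.linear scale (*) f}"

definition two_sided_ideal :: "'k::field gl set \<Rightarrow> bool" where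
  "two_sided_ideal I \<longleftrightarrow> module.subspace scale I \<and>
     (\<forall>x\<in>I. \<forall>a. gl_mult a x \<in> I \<and> gl_mult x a \<in> I)"

text \<open>The quotient by \<open>I\<close> is finite-dimensional iff it is spanned by finitely many cosets.\<close>

definition finite_codim :: "'k::field gl set \<Rightarrow> bool" where
  "finite_codim I \<longleftrightarrow> (\<exists>B. finite B \<and> (\<forall>a. \<exists>b\<in>module.span scale B. a - b \<in> I))"

definition finite_dual :: "('k::field gl \<Rightarrow> 'k) set" where
  "finite_dual = {f \<in> dual. \<exists>I. two_sided_ideal I \<and> finite_codim I \<and> I \<subseteq> {a. f a = 0}}"

definition transpose_map :: "('a \<Rightarrow> 'b) \<Rightarrow> ('b \<Rightarrow> 'k) \<Rightarrow> 'a \<Rightarrow> 'k" where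
  "transpose_map \<phi> f = f \<circ> \<phi>"

text \<open>
  As usual, \<open>A\<^sup>* \<otimes> A\<^sup>*\<close> is regarded as a subspace of \<open>(A \<otimes> A)\<^sup>*\<close>: the functional \<open>f \<otimes> g\<close> sends
  \<open>a \<otimes> b\<close> to \<open>f a * g b\<close>.
\<close>

definition dual_tensor :: "('k::field gl \<Rightarrow> 'k) \<Rightarrow> ('k gl \<Rightarrow> 'k) \<Rightarrow> 'k gl2 \<Rightarrow> 'k" where
  "dual_tensor f g z =
     (\<Sum>p\<in>Poly_Mapping.keys z. Poly_Mapping.lookup z p * (f (basis (fst p)) * g (basis (snd p))))"

definition dual_comult :: "('k::field gl \<Rightarrow> 'k) \<Rightarrow> 'k gl2 \<Rightarrow> 'k" where
  "dual_comult = transpose_map gl_mult_map"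

definition dual_mult :: "('k::field gl \<Rightarrow> 'k) \<Rightarrow> ('k gl \<Rightarrow> 'k) \<Rightarrow> 'k gl \<Rightarrow> 'k" where
  "dual_mult f g = transpose_map gl_comult (dual_tensor f g)"

definition linear_endo_on :: "('k::field gl \<Rightarrow> 'k) set \<Rightarrow> (('k gl \<Rightarrow> 'k) \<Rightarrow> ('k gl \<Rightarrow> 'k)) \<Rightarrow> bool"
  where
  "linear_endo_on V L \<longleftrightarrow> (\<forall>f\<in>V. L f \<in> V) \<and>
     (\<forall>f\<in>V. \<forall>g\<in>V. L (f + g) = L f + L g) \<and> (\<forall>c. \<forall>f\<in>V. L (\<lambda>a. c * f a) = (\<lambda>a. c * L f a))"

text \<open>
  \<open>id_tensor V L\<close> is \<open>id \<otimes> L\<close> on \<open>V \<otimes> V\<close>, for a linear endomorphism \<open>L\<close> of a space \<open>V\<close> of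
  functionals; lemma \<open>id_tensor_sum\<close> below shows that it is well defined.
\<close>

definition id_tensor ::
  "('k::field gl \<Rightarrow> 'k) set \<Rightarrow> (('k gl \<Rightarrow> 'k) \<Rightarrow> ('k gl \<Rightarrow> 'k)) \<Rightarrow> ('k gl2 \<Rightarrow> 'k) \<Rightarrow> 'k gl2 \<Rightarrow> 'k"
  where
  "id_tensor V L T = (THE S. \<exists>(n::nat) F G. (\<forall>i<n. F i \<in> V \<and> G i \<in> V) \<and>
     T = (\<Sum>i<n. dual_tensor (F i) (G i)) \<and> S = (\<Sum>i<n. dual_tensor (F i) (L (G i))))"

text \<open>
  The Hochschild equation on the Hopf algebra \<open>A\<^sup>0\<close>; its unit is the counit of \<open>A\<close> (lemmas
  \<open>dual_mult_counit_left\<close> and \<open>dual_mult_counit_right\<close> below).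
\<close>

definition hochschild_solution :: "(('k::field gl \<Rightarrow> 'k) \<Rightarrow> ('k gl \<Rightarrow> 'k)) \<Rightarrow> bool" where
  "hochschild_solution L \<longleftrightarrow> linear_endo_on finite_dual L \<and>
     (\<forall>f\<in>finite_dual. dual_comult (L f) =
        dual_tensor (L f) gl_counit + id_tensor finite_dual L (dual_comult f))"

section \<open>Consistency of the definitions\<close>

lemma lookup_scale [simp]: "Poly_Mapping.lookup (scale c a) t = c * Poly_Mapping.lookup a t"
  by (simp add: scale_def Poly_Mapping.map.rep_eq when_def)

lemma vector_space_scale: "vector_space scale"
  by unfold_locales (auto intro!: poly_mapping_eqI simp: lookup_add algebra_simps)

lemma count_image_mset_inj:
  assumes "inj f"
  shows "count (image_mset f X) (f w) = count X w"
  using assms by (induction X) (auto simp: inj_eq)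

lemma vertex_mset_map: "vertex_mset (map_ltree f l) = image_mset f (vertex_mset l)"
proof (induction l)
  case (LNode v C)
  then have "image_mset (\<lambda>x. vertex_mset (map_ltree f x)) C =
      image_mset (\<lambda>x. image_mset f (vertex_mset x)) C"
    by (intro image_mset_cong) auto
  moreover have "\<Sum>\<^sub># (image_mset (\<lambda>x. image_mset f (vertex_mset x)) C) =
      image_mset f (\<Sum>\<^sub># (image_mset vertex_mset C))"
    by (induction C) auto
  ultimately show ?case by (simp add: image_mset.compositionality comp_def)
qed

lemma shape_map: "shape (map_ltree f l) = shape l"
proof (induction l)
  case (LNode v C)
  then have "image_mset (\<lambda>x. shape (map_ltree f x)) C = image_mset shape C"
    by (intro image_mset_cong) auto
  then show ?case by (simp add: image_mset.compositionality comp_def)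
qed

lemma exists_represents: "\<exists>l. represents l t"
proof (induction t)
  case (Node M)
  have "\<exists>C :: nat ltree multiset. image_mset shape C = M \<and>
      (\<forall>v. count (\<Sum>\<^sub># (image_mset vertex_mset C)) v \<le> 1)"
    using Node
  proof (induction M)
    case empty
    show ?case by (intro exI[of _ "{#}"]) auto
  next
    case (add t M)
    obtain C :: "nat ltree multiset" where C: "image_mset shape C = M"
      "\<And>v. count (\<Sum>\<^sub># (image_mset vertex_mset C)) v \<le> 1"
      using add.IH add.prems by auto
    have "\<exists>l. represents l t" using add.prems[of t] by simp
    then obtain l :: "nat ltree" where "shape l = t" "\<forall>v. count (vertex_mset l) v \<le> 1"
      unfolding represents_def distinct_names_def by blast
    then have l: "shape l = t" "\<And>v. count (vertex_mset l) v \<le> 1" by blast+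
    define ev od :: "nat \<Rightarrow> nat" where "ev = (\<lambda>n. 2 * n)" and "od = (\<lambda>n. 2 * n + 1)"
    have inj: "inj ev" "inj od" by (auto simp: inj_def ev_def od_def)
    define D where "D = add_mset (map_ltree ev l) (image_mset (map_ltree od) C)"
    have le1: "count (image_mset f X) v \<le> 1" if "inj f" "\<And>v. count X v \<le> 1"
      for f :: "nat \<Rightarrow> nat" and X v
    proof (cases "v \<in> range f")
      case True
      then obtain w where "v = f w" by auto
      then show ?thesis using that count_image_mset_inj[of f X w] by simp
    next
      case False
      then have "v \<notin># image_mset f X" by auto
      then have "count (image_mset f X) v = 0" by (simp only: not_in_iff)
      then show ?thesis by simp
    qed
    have sum: "\<Sum>\<^sub># (image_mset vertex_mset (image_mset (map_ltree od) C)) =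
        image_mset od (\<Sum>\<^sub># (image_mset vertex_mset C))"
      by (induction C) (auto simp: vertex_mset_map)
    have "count (\<Sum>\<^sub># (image_mset vertex_mset D)) v \<le> 1" for v
    proof (cases "even v")
      case True
      then have "v \<notin># image_mset od (\<Sum>\<^sub># (image_mset vertex_mset C))"
        by (auto simp: od_def)
      then have "count (image_mset od (\<Sum>\<^sub># (image_mset vertex_mset C))) v = 0" by (simp only: not_in_iff)
      then show ?thesis
        using le1[OF inj(1) l(2), of v] sum
        by (simp add: D_def vertex_mset_map)
    next
      case False
      then have "v \<notin># image_mset ev (vertex_mset l)" by (auto simp: ev_def)
      then have "count (image_mset ev (vertex_mset l)) v = 0" by (simp only: not_in_iff)
      then show ?thesis
        using le1[OF inj(2) C(2), of v] sum
        by (simp add: D_def vertex_mset_map)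
    qed
    moreover have "image_mset shape D = add_mset t M"
      using C l by (simp add: D_def shape_map image_mset.compositionality comp_def)
    ultimately show ?case by blast
  qed
  then obtain C :: "nat ltree multiset" where C: "image_mset shape C = M"
    "\<And>v. count (\<Sum>\<^sub># (image_mset vertex_mset C)) v \<le> 1" by auto
  have inj: "inj Suc" by simp
  have "vertex_mset (LNode 0 (image_mset (map_ltree Suc) C)) =
      add_mset 0 (image_mset Suc (\<Sum>\<^sub># (image_mset vertex_mset C)))"
    by (induction C) (auto simp: vertex_mset_map)
  moreover have "count (add_mset 0 (image_mset Suc X)) v \<le> 1"
    if "\<And>v. count X v \<le> 1" for X v
  proof (cases v)
    case 0
    then have "v \<notin># image_mset Suc X" by auto
    then have "count (image_mset Suc X) v = 0" by (simp only: not_in_iff)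
    then show ?thesis using 0 by simp
  next
    case (Suc w)
    then show ?thesis using that count_image_mset_inj[OF inj, of X w] by simp
  qed
  ultimately have "distinct_names (LNode 0 (image_mset (map_ltree Suc) C))"
    using C(2) unfolding distinct_names_def by metis
  moreover have "shape (LNode 0 (image_mset (map_ltree Suc) C)) = Node M"
    using C(1) by (simp add: shape_map image_mset.compositionality comp_def)
  ultimately show ?case unfolding represents_def by blast
qed

lemma represents_named: "represents (named t) t"
  unfolding named_def by (rule someI_ex[OF exists_represents])

lemma shape_named [simp]: "shape (named t) = t"
  using represents_named by (simp add: represents_def)

lemma distinct_names_named: "distinct_names (named t)"
  using represents_named by (simp add: represents_def)

lemma distinct_names_children:
  assumes "distinct_names l"
  shows "lchildren l = mset_set (set_mset (lchildren l))"
proof (cases l)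
  case (LNode v C)
  have le1: "count C c \<le> 1" for c
  proof (rule ccontr)
    assume "\<not> count C c \<le> 1"
    then have "{#c, c#} \<subseteq># C"
      by (simp add: subseteq_mset_def)
    then obtain D where D: "C = {#c, c#} + D" by (metis subset_mset.le_iff_add)
    obtain w where "w \<in># vertex_mset c" by (cases c) auto
    then have "count (vertex_mset c) w \<ge> 1" by simp
    moreover have "vertex_mset l =
        add_mset v (vertex_mset c + (vertex_mset c + \<Sum>\<^sub># (image_mset vertex_mset D)))"
      by (simp add: LNode D)
    ultimately have "count (vertex_mset l) w \<ge> 2"
      by (simp only: count_add_mset count_union split: if_split) linarith
    then show False using assms unfolding distinct_names_def by (metis le_trans numeral_le_one_iff semiring_norm(69))
  qed
  have "C = mset_set (set_mset C)"
  proof (rule multiset_eqI)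
    fix c
    show "count C c = count (mset_set (set_mset C)) c"
    proof (cases "c \<in># C")
      case True
      then have "count C c > 0" by simp
      with le1[of c] have "count C c = 1" by linarith
      then show ?thesis using True by simp
    next
      case False
      then show ?thesis by (simp add: not_in_iff)
    qed
  qed
  then show ?thesis by (simp add: LNode)
qed

lemma finite_root_children [simp]: "finite (root_children t)"
  by (simp add: root_children_def)

lemma Node_subtrees_of_root_children [simp]: "Node (subtrees_of (root_children t)) = t"
proof -
  have "t = Node (image_mset shape (lchildren (named t)))"
    using shape_named[of t] by (cases "named t") simp
  then show ?thesis
    using distinct_names_children[OF distinct_names_named[of t]]
    by (simp add: subtrees_of_def root_children_def)
qed

lemma basis_expand:
  fixes a :: "'b \<Rightarrow>\<^sub>0 'k::field"
  shows "a = (\<Sum>t\<in>Poly_Mapping.keys a. scale (Poly_Mapping.lookup a t) (basis t))"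
proof (rule poly_mapping_eqI)
  fix s
  have "(\<Sum>t\<in>Poly_Mapping.keys a. Poly_Mapping.lookup (scale (Poly_Mapping.lookup a t) (basis t)) s) =
      (\<Sum>t\<in>Poly_Mapping.keys a. if t = s then Poly_Mapping.lookup a s else 0)"
    by (rule sum.cong) (auto simp: basis_def lookup_single when_def)
  then show "Poly_Mapping.lookup a s = Poly_Mapping.lookup
      (\<Sum>t\<in>Poly_Mapping.keys a. scale (Poly_Mapping.lookup a t) (basis t)) s"
    by (simp add: lookup_sum in_keys_iff)
qed

lemma dual_tensor_basis [simp]: "dual_tensor f g (basis (s, t)) = f (basis s) * g (basis t)"
  by (simp add: dual_tensor_def basis_def)

lemma dual_tensor_eqI:
  fixes n m :: nat
  assumes "\<And>s t. (\<Sum>i<n. f i (basis s) * g i (basis t)) = (\<Sum>i<m. f' i (basis s) * g' i (basis t))"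
  shows "(\<Sum>i<n. dual_tensor (f i) (g i)) =
    (\<Sum>i<m. dual_tensor (f' i) (g' i))" (is "?l = ?r")
proof
  fix z
  have app: "(\<Sum>i<k. H i) z = (\<Sum>i<k. H i z)" for k :: nat and H :: "nat \<Rightarrow> 'a gl2 \<Rightarrow> 'a"
    by (induction k) auto
  have *: "(\<Sum>i<k. dual_tensor (F i) (G i) z) = (\<Sum>p\<in>Poly_Mapping.keys z. Poly_Mapping.lookup z p *
      (\<Sum>i<k. F i (basis (fst p)) * G i (basis (snd p))))" for k :: nat and F G :: "nat \<Rightarrow> 'a gl \<Rightarrow> 'a"
    unfolding dual_tensor_def by (subst sum.swap) (simp add: sum_distrib_left)
  show "?l z = ?r z" by (simp only: app * assms)
qed

lemma id_tensor_sum: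
  fixes n :: nat
  assumes L: "linear_endo_on V L"
    and zero: "(\<lambda>_. 0) \<in> V"
    and add: "\<And>f g. f \<in> V \<Longrightarrow> g \<in> V \<Longrightarrow> f + g \<in> V"
    and scale: "\<And>c f. f \<in> V \<Longrightarrow> (\<lambda>a. c * f a) \<in> V"
    and dual: "V \<subseteq> dual"
    and FG: "\<And>i. i < n \<Longrightarrow> F i \<in> V \<and> G i \<in> V"
  shows "id_tensor V L (\<Sum>i<n. dual_tensor (F i) (G i)) = (\<Sum>i<n. dual_tensor (F i) (L (G i)))"
proof -
  have app: "(\<Sum>i<k. H i) z = (\<Sum>i<k. H i z)"
    for k :: nat and H :: "nat \<Rightarrow> 'c \<Rightarrow> 'a" and z
    by (induction k) auto
  have L0: "L (\<lambda>_. 0) = (\<lambda>_. 0)"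
  proof -
    have "L (\<lambda>a. 0 * h a) = (\<lambda>a. 0 * L h a)" if "h \<in> V" for h
      using L that unfolding linear_endo_on_def by blast
    from this[OF zero] show ?thesis by simp
  qed
  have comb: "(\<Sum>i<k. (\<lambda>a. c i * H i a)) \<in> V \<and>
      L (\<Sum>i<k. (\<lambda>a. c i * H i a)) = (\<Sum>i<k. (\<lambda>a. c i * L (H i) a))"
    if "\<And>i. i < k \<Longrightarrow> H i \<in> V" for k :: nat and c :: "nat \<Rightarrow> 'a" and H
    using that
  proof (induction k)
    case 0
    then show ?case using zero L0 by (simp add: zero_fun_def)
  next
    case (Suc k)
    have IH: "(\<Sum>i<k. (\<lambda>a. c i * H i a)) \<in> V"
      "L (\<Sum>i<k. (\<lambda>a. c i * H i a)) = (\<Sum>i<k. (\<lambda>a. c i * L (H i) a))"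
      using Suc by auto
    have H: "H k \<in> V" "(\<lambda>a. c k * H k a) \<in> V" using Suc.prems scale by auto
    have "L ((\<Sum>i<k. (\<lambda>a. c i * H i a)) + (\<lambda>a. c k * H k a)) =
        (\<Sum>i<k. (\<lambda>a. c i * L (H i) a)) + (\<lambda>a. c k * L (H k) a)"
    proof -
      have "L (f + g) = L f + L g" if "f \<in> V" "g \<in> V" for f g
        using L that unfolding linear_endo_on_def by blast
      moreover have "L (\<lambda>a. c k * H k a) = (\<lambda>a. c k * L (H k) a)"
        using L H(1) unfolding linear_endo_on_def by blast
      ultimately show ?thesis using H IH by simp
    qed
    then show ?case using add[OF IH(1) H(2)] by (simp add: plus_fun_def)
  qed
  have dual_eq: "f = g" if "f \<in> V" "g \<in> V" "\<And>t. f (basis t) = g (basis t)" for f g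
  proof -
    have lin: "Vector_Spaces.linear Defs.scale (*) f" "Vector_Spaces.linear Defs.scale (*) g"
      using that dual by (auto simp: dual_def)
    interpret f: Vector_Spaces.linear Defs.scale "(*)" f by (rule lin)
    interpret g: Vector_Spaces.linear Defs.scale "(*)" g by (rule lin)
    show "f = g"
    proof
      fix a
      show "f a = g a"
        using arg_cong[OF basis_expand[of a], of f] arg_cong[OF basis_expand[of a], of g]
        by (simp add: f.sum f.scale g.sum g.scale that(3))
    qed
  qed
  have unique: "(\<Sum>i<n. dual_tensor (F i) (L (G i))) = (\<Sum>i<m. dual_tensor (F' i) (L (G' i)))"
    if FG': "\<And>i. i < m \<Longrightarrow> F' i \<in> V \<and> G' i \<in> V"
      and eq: "(\<Sum>i<n. dual_tensor (F i) (G i)) = (\<Sum>i<m. dual_tensor (F' i) (G' i))"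
    for m :: nat and F' G'
  proof (rule dual_tensor_eqI)
    fix s t
    have "(\<Sum>i<n. (\<lambda>a. F i (basis s) * G i a)) = (\<Sum>i<m. (\<lambda>a. F' i (basis s) * G' i a))"
    proof (rule dual_eq)
      fix u
      show "(\<Sum>i<n. (\<lambda>a. F i (basis s) * G i a)) (basis u) =
          (\<Sum>i<m. (\<lambda>a. F' i (basis s) * G' i a)) (basis u)"
        using fun_cong[OF eq, of "basis (s, u)"] by (simp add: app)
    qed (use comb FG FG' in auto)
    then have "(\<Sum>i<n. (\<lambda>a. F i (basis s) * L (G i) a)) =
        (\<Sum>i<m. (\<lambda>a. F' i (basis s) * L (G' i) a))"
      using comb[of n G "\<lambda>i. F i (basis s)"] comb[of m G' "\<lambda>i. F' i (basis s)"] FG FG' by simp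
    from fun_cong[OF this, of "basis t"]
    show "(\<Sum>i<n. F i (basis s) * L (G i) (basis t)) =
        (\<Sum>i<m. F' i (basis s) * L (G' i) (basis t))"
      by (simp add: app)
  qed
  show ?thesis
    unfolding id_tensor_def
  proof (rule the_equality)
    show "\<exists>(n'::nat) F' G'. (\<forall>i<n'. F' i \<in> V \<and> G' i \<in> V) \<and>
        (\<Sum>i<n. dual_tensor (F i) (G i)) = (\<Sum>i<n'. dual_tensor (F' i) (G' i)) \<and>
        (\<Sum>i<n. dual_tensor (F i) (L (G i))) = (\<Sum>i<n'. dual_tensor (F' i) (L (G' i)))"
      using FG by (intro exI[of _ n] exI[of _ F] exI[of _ G]) simp
  next
    fix S
    assume "\<exists>(n'::nat) F' G'. (\<forall>i<n'. F' i \<in> V \<and> G' i \<in> V) \<and>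
        (\<Sum>i<n. dual_tensor (F i) (G i)) = (\<Sum>i<n'. dual_tensor (F' i) (G' i)) \<and>
        S = (\<Sum>i<n'. dual_tensor (F' i) (L (G' i)))"
    then obtain n' :: nat and F' G' where *: "\<forall>i<n'. F' i \<in> V \<and> G' i \<in> V"
      "(\<Sum>i<n. dual_tensor (F i) (G i)) = (\<Sum>i<n'. dual_tensor (F' i) (G' i))"
      "S = (\<Sum>i<n'. dual_tensor (F' i) (L (G' i)))" by blast
    have "(\<Sum>i<n. dual_tensor (F i) (L (G i))) = (\<Sum>i<n'. dual_tensor (F' i) (L (G' i)))"
      by (rule unique) (use * in auto)
    then show "S = (\<Sum>i<n. dual_tensor (F i) (L (G i)))" using *(3) by simp
  qed
qed

lemma vector_space_mult: "vector_space ((*) :: 'k::field \<Rightarrow> 'k \<Rightarrow> 'k)"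
  by unfold_locales (auto simp: algebra_simps)

lemma dual_lincomb:
  assumes "f \<in> dual"
  shows "f (\<Sum>x\<in>X. c x) = (\<Sum>x\<in>X. f (c x))" "f (scale r a) = r * f a"
proof -
  interpret f: Vector_Spaces.linear scale "(*)" f using assms by (simp add: dual_def)
  show "f (\<Sum>x\<in>X. c x) = (\<Sum>x\<in>X. f (c x))" "f (scale r a) = r * f a"
    by (simp_all add: f.sum f.scale)
qed

lemma dual_tensor_superset:
  assumes "finite P" "Poly_Mapping.keys z \<subseteq> P"
  shows "dual_tensor f g z =
    (\<Sum>p\<in>P. Poly_Mapping.lookup z p * (f (basis (fst p)) * g (basis (snd p))))"
  unfolding dual_tensor_def
  by (rule sum.mono_neutral_left) (use assms in \<open>auto simp: in_keys_iff\<close>)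

lemma dual_tensor_add: "dual_tensor f g (y + z) = dual_tensor f g y + dual_tensor f g z"
proof -
  let ?P = "Poly_Mapping.keys y \<union> Poly_Mapping.keys z"
  have "Poly_Mapping.keys (y + z) \<subseteq> ?P" by (rule Poly_Mapping.keys_add)
  then show ?thesis
    using dual_tensor_superset[of ?P "y + z" f g] dual_tensor_superset[of ?P y f g]
      dual_tensor_superset[of ?P z f g]
    by (simp add: lookup_add distrib_right sum.distrib)
qed

lemma dual_tensor_zero: "dual_tensor f g 0 = 0"
  by (simp add: dual_tensor_def)

lemma dual_tensor_sum: "dual_tensor f g (\<Sum>x\<in>X. c x) = (\<Sum>x\<in>X. dual_tensor f g (c x))"
  by (induction X rule: infinite_finite_induct) (auto simp: dual_tensor_add dual_tensor_zero)

lemma dual_tensor_scale: "dual_tensor f g (scale r z) = r * dual_tensor f g z"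
proof -
  have "Poly_Mapping.keys (scale r z) \<subseteq> Poly_Mapping.keys z" by (auto simp: in_keys_iff)
  then show ?thesis
    using dual_tensor_superset[of "Poly_Mapping.keys z" "scale r z" f g]
    by (simp add: dual_tensor_def sum_distrib_left mult.assoc)
qed

lemma gl_counit_basis: "gl_counit (basis t :: 'k::field gl) = (if t = e_tree then 1 else 0)"
  by (simp add: gl_counit_def basis_def lookup_single when_def)

lemma Node_subtrees_of_eq_e:
  assumes "finite S"
  shows "Node (subtrees_of S) = e_tree \<longleftrightarrow> S = {}"
  using assms by (simp add: subtrees_of_def e_tree_def mset_set_empty_iff)

lemma dual_mult_expand:
  "dual_mult f g a = (\<Sum>t\<in>Poly_Mapping.keys a. Poly_Mapping.lookup a t *
     (\<Sum>S\<in>Pow (root_children t). f (basis (Node (subtrees_of S))) *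
        g (basis (Node (subtrees_of (root_children t - S))))))"
  by (simp add: dual_mult_def transpose_map_def gl_comult_def lin_ext_def dual_tensor_sum
      dual_tensor_scale)

lemma dual_mult_counit_left:
  assumes "f \<in> dual"
  shows "dual_mult gl_counit f = f"
proof
  fix a
  have "(\<Sum>S\<in>Pow (root_children t). gl_counit (basis (Node (subtrees_of S))) *
        f (basis (Node (subtrees_of (root_children t - S))))) = f (basis t)" for t
  proof -
    have "(\<Sum>S\<in>Pow (root_children t). gl_counit (basis (Node (subtrees_of S))) *
        f (basis (Node (subtrees_of (root_children t - S))))) =
      (\<Sum>S\<in>Pow (root_children t). if S = {} then f (basis t) else 0)"
    proof (rule sum.cong)
      fix S assume "S \<in> Pow (root_children t)"
      then have "finite S" by (auto intro: finite_subset)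
      then show "gl_counit (basis (Node (subtrees_of S))) *
          f (basis (Node (subtrees_of (root_children t - S)))) = (if S = {} then f (basis t) else 0)"
        by (simp add: gl_counit_basis Node_subtrees_of_eq_e)
    qed simp
    then show ?thesis by simp
  qed
  then have "dual_mult gl_counit f a =
      (\<Sum>t\<in>Poly_Mapping.keys a. Poly_Mapping.lookup a t * f (basis t))"
    by (simp add: dual_mult_expand)
  also have "\<dots> = f a"
    using arg_cong[OF basis_expand[of a], of f] by (simp add: dual_lincomb[OF assms])
  finally show "dual_mult gl_counit f a = f a" .
qed

lemma dual_mult_counit_right:
  fixes f :: "'a::field gl \<Rightarrow> 'a"
  assumes "f \<in> dual"
  shows "dual_mult f gl_counit = f"
proof
  fix a
  have "(\<Sum>S\<in>Pow (root_children t). f (basis (Node (subtrees_of S))) *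
        gl_counit (basis (Node (subtrees_of (root_children t - S))))) = f (basis t)" for t
  proof -
    have "(\<Sum>S\<in>Pow (root_children t). f (basis (Node (subtrees_of S))) *
        gl_counit (basis (Node (subtrees_of (root_children t - S))))) =
      (\<Sum>S\<in>Pow (root_children t). if S = root_children t then f (basis t) else 0)"
    proof (rule sum.cong)
      fix S assume "S \<in> Pow (root_children t)"
      then have "root_children t - S = {} \<longleftrightarrow> S = root_children t" by auto
      then have "gl_counit (basis (Node (subtrees_of (root_children t - S))) :: 'a gl) =
          (if S = root_children t then 1 else 0)"
        by (simp add: gl_counit_basis Node_subtrees_of_eq_e)
      then show "f (basis (Node (subtrees_of S))) *
          gl_counit (basis (Node (subtrees_of (root_children t - S)))) =
          (if S = root_children t then f (basis t) else 0)"
        by simp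
    qed simp
    then show ?thesis by simp
  qed
  then have "dual_mult f gl_counit a =
      (\<Sum>t\<in>Poly_Mapping.keys a. Poly_Mapping.lookup a t * f (basis t))"
    by (simp add: dual_mult_expand)
  also have "\<dots> = f a"
    using arg_cong[OF basis_expand[of a], of f] by (simp add: dual_lincomb[OF assms])
  finally show "dual_mult f gl_counit a = f a" .
qed

end

(* Write x for the two-vertex tree N(e). Since e x = x, the map M is a |-> a x - eps(a) x, so
   M^*(f) = f(- x) - f(x) eps, which lies in A^0 because f(- x) vanishes on every ideal on which f
   vanishes. If f(ab) = sum_i f_i(a) f'_i(b), then evaluating both sides of the Hochschild equation
   on a (x) b gives f(abx) - eps(ab) f(x); this uses multiplicativity of eps and the single instance
   (ab) x = a (bx) of associativity. For that instance one compares, for trees s and t, grafting s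
   onto t and then splitting the children of the root into two groups, with splitting the children
   of the root of t first and then grafting s onto the tree with one more vertex. *)
theory Submission
  imports Defs "HOL-Combinatorics.Permutations"
begin

section \<open>Linear extension from trees and bilinearity of the product\<close>

interpretation gl: vector_space scale
  by (rule vector_space_scale)

lemma lin_ext_superset:
  assumes "finite P" "Poly_Mapping.keys a \<subseteq> P"
  shows "lin_ext F a = (\<Sum>t\<in>P. scale (Poly_Mapping.lookup a t) (F t))"
  unfolding lin_ext_def
  by (rule sum.mono_neutral_left) (use assms in \<open>auto simp: in_keys_iff\<close>)

lemma lin_ext_add: "lin_ext F (a + b) = lin_ext F a + lin_ext F b"
proof -
  let ?P = "Poly_Mapping.keys a \<union> Poly_Mapping.keys b"
  have "Poly_Mapping.keys (a + b) \<subseteq> ?P" by (rule Poly_Mapping.keys_add)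
  then show ?thesis
    using lin_ext_superset[of ?P "a + b" F] lin_ext_superset[of ?P a F] lin_ext_superset[of ?P b F]
    by (simp add: lookup_add gl.scale_left_distrib sum.distrib)
qed

lemma lin_ext_scale: "lin_ext F (scale c a) = scale c (lin_ext F a)"
proof -
  have "Poly_Mapping.keys (scale c a) \<subseteq> Poly_Mapping.keys a" by (auto simp: in_keys_iff)
  then show ?thesis
    using lin_ext_superset[of "Poly_Mapping.keys a" "scale c a" F]
    by (simp add: lin_ext_def gl.scale_sum_right)
qed

lemma linear_lin_ext: "Vector_Spaces.linear scale scale (lin_ext F)"
  by (simp add: Vector_Spaces.linear_iff lin_ext_add lin_ext_scale vector_space_scale)

lemma lin_ext_sum: "lin_ext F (\<Sum>x\<in>X. a x) = (\<Sum>x\<in>X. lin_ext F (a x))"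
  by (induction X rule: infinite_finite_induct) (auto simp: lin_ext_add lin_ext_def[of _ 0])

lemma lin_ext_basis [simp]: "lin_ext F (basis t) = F t"
  by (simp add: lin_ext_def basis_def)

lemma lin_ext_basis_id: "lin_ext basis a = a"
  unfolding lin_ext_def by (rule basis_expand[symmetric])

lemma lin_ext_fun_add: "lin_ext (\<lambda>t. F t + G t) a = lin_ext F a + lin_ext G a"
  by (simp add: lin_ext_def gl.scale_right_distrib sum.distrib)

lemma lin_ext_fun_scale: "lin_ext (\<lambda>t. scale c (F t)) a = scale c (lin_ext F a)"
  by (simp add: lin_ext_def gl.scale_sum_right mult.commute)

lemma dual_lin_ext:
  "f \<in> dual \<Longrightarrow> f (lin_ext F a) = (\<Sum>t\<in>Poly_Mapping.keys a. Poly_Mapping.lookup a t * f (F t))"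
  by (simp add: lin_ext_def dual_lincomb)

text \<open>Written as an iterated linear extension, the product is visibly linear in each
  factor.\<close>

lemma gl_mult_lin_ext: "gl_mult a b = lin_ext (\<lambda>s. lin_ext (tree_mult s) b) a"
  unfolding gl_mult_def gl_mult_map_def tensor_def lin_ext_sum lin_ext_scale lin_ext_basis
  by (simp add: lin_ext_def gl.scale_sum_right)

lemma gl_mult_basis [simp]: "gl_mult (basis s) (basis t) = tree_mult s t"
  by (simp add: gl_mult_lin_ext)

lemma linear_gl_mult_left: "Vector_Spaces.linear scale scale (\<lambda>a. gl_mult a b)"
  unfolding gl_mult_lin_ext by (rule linear_lin_ext)

lemma linear_gl_mult_right: "Vector_Spaces.linear scale scale (gl_mult a)"
  by (simp add: Vector_Spaces.linear_iff gl_mult_lin_ext lin_ext_add lin_ext_scale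
      lin_ext_fun_add lin_ext_fun_scale vector_space_scale)

section \<open>Linear functionals on A\<close>

lemma dual_iff:
  "f \<in> dual \<longleftrightarrow> (\<forall>a b. f (a + b) = f a + f b) \<and> (\<forall>c a. f (scale c a) = c * f a)"
  unfolding dual_def Vector_Spaces.linear_iff using vector_space_scale vector_space_mult by blast

lemma dual_add: "f \<in> dual \<Longrightarrow> f (a + b) = f a + f b"
  unfolding dual_iff by blast

lemma dual_zero:
  assumes "f \<in> dual"
  shows "f 0 = 0"
  using dual_lincomb(2)[OF assms, of 0 0] by simp

lemma dual_diff:
  assumes "f \<in> dual"
  shows "f (a - b) = f a - f b"
proof -
  have "f a = f (a - b) + f b" using dual_add[OF assms, of "a - b" b] by (simp only: diff_add_cancel)
  then show ?thesis by (simp only: add_diff_cancel_right')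
qed

lemma dualI:
  assumes "\<And>a b. f (a + b) = f a + f b" "\<And>c a. f (scale c a) = c * f a"
  shows "f \<in> dual"
  unfolding dual_iff using assms by blast

lemma dual_compose:
  assumes "f \<in> dual" "Vector_Spaces.linear scale scale T"
  shows "(\<lambda>a. f (T a)) \<in> dual"
  using assms unfolding dual_iff Vector_Spaces.linear_iff by simp

section \<open>Cofinite ideals\<close>

lemma finite_codim_mono: "finite_codim I \<Longrightarrow> I \<subseteq> J \<Longrightarrow> finite_codim J"
  unfolding finite_codim_def by (meson subsetD)

text \<open>Cutting with one hyperplane costs at most one dimension: if \<open>f\<close> does not
  vanish on \<open>I\<close>, one vector \<open>k\<close> of \<open>I\<close> with
  \<open>f k\<close> nonzero joins the finite spanning set, and a multiple of \<open>k\<close>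
  corrects the remainder.\<close>

lemma finite_codim_Int_kernel:
  assumes I: "finite_codim I" "gl.subspace I" and f: "f \<in> dual"
  shows "finite_codim (I \<inter> {a. f a = 0})"
proof (cases "I \<subseteq> {a. f a = 0}")
  case True
  then show ?thesis using I by (simp add: Int_absorb2)
next
  case False
  then obtain k where k: "k \<in> I" "f k \<noteq> 0" by auto
  obtain B where B: "finite B" "\<And>a. \<exists>b\<in>gl.span B. a - b \<in> I"
    using I(1) unfolding finite_codim_def by blast
  show ?thesis
    unfolding finite_codim_def
  proof (intro exI[of _ "insert k B"] conjI allI)
    fix a
    obtain b where b: "b \<in> gl.span B" "a - b \<in> I" using B(2) by blast
    define c where "c = f (a - b) / f k"
    have "b + scale c k \<in> gl.span (insert k B)"
      using gl.span_mono[OF subset_insertI, of B k] b(1)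
      by (intro gl.span_add gl.span_scale) (auto intro: gl.span_base)
    moreover have "(a - b) - scale c k \<in> I"
      using I(2) b(2) k(1) by (simp add: gl.subspace_diff gl.subspace_scale)
    moreover have "f ((a - b) - scale c k) = 0"
      using k(2) by (simp add: dual_diff[OF f] dual_lincomb(2)[OF f] c_def)
    ultimately show "\<exists>b\<in>gl.span (insert k B). a - b \<in> I \<inter> {a. f a = 0}"
      by (intro bexI[of _ "b + scale c k"]) (auto simp: diff_diff_eq)
  qed (use B in simp)
qed

lemma subspace_kernel: "f \<in> dual \<Longrightarrow> gl.subspace {a. f a = 0}"
  by (auto simp: gl.subspace_def dual_add dual_zero dual_lincomb(2))

text \<open>The \<open>c b\<close> are the coordinates of the quotient by \<open>I\<close>, lifted
  to functionals on all of A. Since they vanish on \<open>I\<close>, they lie in the finite dual as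
  soon as \<open>I\<close> is a two-sided ideal.\<close>

lemma finite_codim_coordinates:
  fixes I :: "'k::field gl set"
  assumes I: "gl.subspace I" "finite_codim I"
  obtains B c where "finite B" "\<And>b. c b \<in> dual" "\<And>b a. b \<in> B \<Longrightarrow> a \<in> I \<Longrightarrow> c b a = 0"
    "\<And>a. a - (\<Sum>b\<in>B. scale (c b a) b) \<in> I"
proof -
  obtain B where B: "finite B" "\<And>a. \<exists>b\<in>gl.span B. a - b \<in> I"
    using I(2) unfolding finite_codim_def by blast
  \<comment> \<open>Extend a basis \<open>BI\<close> of \<open>I\<close> to a basis \<open>B'\<close> of the whole space; the
    coordinates along \<open>B' - BI\<close> vanish on \<open>I\<close>.\<close>
  obtain BI where BI: "BI \<subseteq> I" "gl.independent BI" "I \<subseteq> gl.span BI"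
    using gl.maximal_independent_subset[of I] by blast
  then have sBI: "gl.span BI = I" using I(1) by (metis gl.span_minimal subset_antisym)
  obtain B' where B': "BI \<subseteq> B'" "B' \<subseteq> BI \<union> B" "gl.independent B'" "BI \<union> B \<subseteq> gl.span B'"
    using gl.maximal_independent_subset_extend[of BI "BI \<union> B"] BI(2) by auto
  have span: "a \<in> gl.span B'" for a
  proof -
    obtain b where b: "b \<in> gl.span B" "a - b \<in> I" using B(2) by blast
    have "b \<in> gl.span B'"
      using b(1) B'(4) gl.span_minimal[of B "gl.span B'"] by auto
    moreover have "a - b \<in> gl.span B'" using b(2) B'(1) sBI gl.span_mono by blast
    ultimately show ?thesis using gl.span_add by fastforce
  qed
  define c where "c b a = gl.representation B' a b" for b a
  \<comment> \<open>\<open>B'\<close> adds to \<open>BI\<close> only vectors of the finite set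
    \<open>B\<close>.\<close>
  have fin: "finite (B' - BI)" using B(1) B'(2) by (meson Diff_subset_conv finite_subset)
  show thesis
  proof (rule that[of "B' - BI" c])
    show "c b \<in> dual" for b
      unfolding c_def
      by (rule dualI)
        (simp_all add: gl.representation_add gl.representation_scale B'(3) span)
    show "c b a = 0" if "b \<in> B' - BI" "a \<in> I" for a b
    proof -
      \<comment> \<open>On the span of \<open>BI\<close>, which is \<open>I\<close>, the larger
        basis gives the same representation, so no vector outside \<open>BI\<close> occurs in
        it.\<close>
      have "gl.representation B' a = gl.representation BI a"
        using that sBI by (intro gl.representation_extend) (auto simp: B')
      then show ?thesis using that gl.representation_ne_zero[of BI a b] by (auto simp: c_def)
    qed
    show "a - (\<Sum>b\<in>B' - BI. scale (c b a) b) \<in> I" for a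
    proof -
      let ?K = "{b. gl.representation B' a b \<noteq> 0}"
      have finK: "finite ?K" by (rule gl.finite_representation)
      have K: "?K \<subseteq> B'" using gl.representation_ne_zero by auto
      have "a = (\<Sum>b\<in>?K. scale (c b a) b)"
        using gl.sum_nonzero_representation_eq[OF B'(3) span, of a] by (simp add: c_def)
      also have "\<dots> = (\<Sum>b\<in>?K \<inter> BI. scale (c b a) b) + (\<Sum>b\<in>?K - BI. scale (c b a) b)"
        using finK by (simp add: sum.Int_Diff)
      also have "(\<Sum>b\<in>?K - BI. scale (c b a) b) = (\<Sum>b\<in>B' - BI. scale (c b a) b)"
        by (rule sum.mono_neutral_left) (use fin K in \<open>auto simp: c_def\<close>)
      finally have "a - (\<Sum>b\<in>B' - BI. scale (c b a) b) = (\<Sum>b\<in>?K \<inter> BI. scale (c b a) b)"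
        by (subst diff_eq_eq)
      also have "\<dots> \<in> I"
        using I(1) BI(1) by (intro gl.subspace_sum gl.subspace_scale) auto
      finally show ?thesis .
    qed
  qed (rule fin)
qed

lemma finite_codim_Int_kernels:
  assumes "finite X" "finite_codim I" "gl.subspace I" "\<And>x. f x \<in> dual"
  shows "finite_codim (I \<inter> {a. \<forall>x\<in>X. f x a = 0}) \<and> gl.subspace (I \<inter> {a. \<forall>x\<in>X. f x a = 0})"
  using assms(1)
proof (induction X)
  case empty
  then show ?case using assms by simp
next
  case (insert x X)
  have "I \<inter> {a. \<forall>y\<in>insert x X. f y a = 0} =
      (I \<inter> {a. \<forall>y\<in>X. f y a = 0}) \<inter> {a. f x a = 0}" by auto
  then show ?case
    using insert.IH finite_codim_Int_kernel[OF _ _ assms(4)]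
      gl.subspace_inter[OF _ subspace_kernel[OF assms(4)]] by simp
qed

text \<open>\<open>J\<close> contains the common kernel of finitely many functionals, namely the
  coordinates modulo \<open>J\<close>, so it is enough to cut \<open>I\<close> with hyperplanes one
  at a time.\<close>

lemma finite_codim_Int:
  assumes I: "finite_codim I" "gl.subspace I" and J: "finite_codim J" "gl.subspace J"
  shows "finite_codim (I \<inter> J)"
proof -
  obtain B c where B: "finite B" "\<And>b. c b \<in> dual" "\<And>b a. b \<in> B \<Longrightarrow> a \<in> J \<Longrightarrow> c b a = 0"
    "\<And>a. a - (\<Sum>b\<in>B. scale (c b a) b) \<in> J"
    by (rule finite_codim_coordinates[OF J(2,1)]) blast
  have "a \<in> J" if "\<forall>b\<in>B. c b a = 0" for a
    using B(4)[of a] that by simp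
  then show ?thesis
    using finite_codim_Int_kernels[OF B(1) I, of c] B(2)
    by (auto elim!: finite_codim_mono)
qed

section \<open>The finite dual as a vector space, and its comultiplication\<close>

lemma two_sided_ideal_Int:
  "two_sided_ideal I \<Longrightarrow> two_sided_ideal J \<Longrightarrow> two_sided_ideal (I \<inter> J)"
  by (auto simp: two_sided_ideal_def gl.subspace_inter)

text \<open>The intersection of the two cofinite ideals serves for the sum.\<close>

lemma finite_dual_add:
  assumes f: "f \<in> finite_dual" and g: "g \<in> finite_dual"
  shows "f + g \<in> finite_dual"
proof -
  obtain I J where I: "two_sided_ideal I" "finite_codim I" "I \<subseteq> {a. f a = 0}"
    and J: "two_sided_ideal J" "finite_codim J" "J \<subseteq> {a. g a = 0}"
    and fg: "f \<in> dual" "g \<in> dual"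
    using f g by (auto simp: finite_dual_def)
  have "f + g \<in> dual"
    by (rule dualI) (simp_all add: fg dual_add dual_lincomb(2) algebra_simps)
  moreover have "finite_codim (I \<inter> J)"
    using I J by (simp add: finite_codim_Int two_sided_ideal_def)
  moreover have "I \<inter> J \<subseteq> {a. (f + g) a = 0}"
    using I(3) J(3) by fastforce
  ultimately show ?thesis
    using two_sided_ideal_Int[OF I(1) J(1)] unfolding finite_dual_def by blast
qed

lemma finite_dual_scale:
  assumes f: "f \<in> finite_dual"
  shows "(\<lambda>a. c * f a) \<in> finite_dual"
proof -
  have "(\<lambda>a. c * f a) \<in> dual" if "f \<in> dual"
    by (rule dualI) (simp_all add: that dual_add dual_lincomb(2) algebra_simps)
  then show ?thesis using f by (fastforce simp: finite_dual_def)
qed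

lemma finite_dual_zero: "(\<lambda>_ :: 'k::field gl. 0) \<in> finite_dual"
proof -
  have "(\<lambda>_ :: 'k gl. 0) \<in> dual" by (rule dualI) simp_all
  moreover have "finite_codim (UNIV :: 'k gl set)" "two_sided_ideal (UNIV :: 'k gl set)"
    by (auto simp: two_sided_ideal_def finite_codim_def)
  ultimately show ?thesis
    unfolding finite_dual_def by blast
qed

text \<open>Modulo the ideal \<open>I\<close> the left factor is a combination of the finite set
  \<open>B\<close>, with its coordinates as coefficients, and \<open>f\<close> vanishes on the right
  multiples of the remainder. Both tensor factors vanish on \<open>I\<close>: the coordinates by
  construction, the functionals \<open>f (gl_mult x _)\<close> because \<open>I\<close> absorbs left
  multiplication.\<close>

lemma finite_dual_gl_mult_decomposition:
  fixes f :: "'k::field gl \<Rightarrow> 'k"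
  assumes f: "f \<in> finite_dual"
  obtains n :: nat and F G where "\<And>i. i < n \<Longrightarrow> F i \<in> finite_dual \<and> G i \<in> finite_dual"
    "\<And>a b. f (gl_mult a b) = (\<Sum>i<n. F i a * G i b)"
proof -
  obtain I where I: "two_sided_ideal I" "finite_codim I" "\<And>a. a \<in> I \<Longrightarrow> f a = 0" and fd: "f \<in> dual"
    using f by (auto simp: finite_dual_def)
  have sI: "gl.subspace I" using I(1) by (simp add: two_sided_ideal_def)
  obtain B c where B: "finite B" "\<And>b. c b \<in> dual" "\<And>b a. b \<in> B \<Longrightarrow> a \<in> I \<Longrightarrow> c b a = 0"
    "\<And>a. a - (\<Sum>b\<in>B. scale (c b a) b) \<in> I"
    by (rule finite_codim_coordinates[OF sI I(2)]) blast
  obtain h where h: "bij_betw h {..<card B} B"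
    using ex_bij_betw_nat_finite[OF B(1)] by (auto simp: atLeast0LessThan)
  show thesis
  proof (rule that[of "card B" "\<lambda>i. c (h i)" "\<lambda>i b. f (gl_mult (h i) b)"])
    fix i assume "i < card B"
    then have hi: "h i \<in> B" using h by (auto simp: bij_betw_def)
    have "c (h i) \<in> finite_dual"
      using B(2,3) hi I(1,2) unfolding finite_dual_def by blast
    moreover have "(\<lambda>b. f (gl_mult (h i) b)) \<in> finite_dual"
      using I dual_compose[OF fd linear_gl_mult_right]
      unfolding finite_dual_def two_sided_ideal_def by blast
    ultimately show "c (h i) \<in> finite_dual \<and> (\<lambda>b. f (gl_mult (h i) b)) \<in> finite_dual" ..
  next
    fix a b :: "'k gl"
    have lin: "(\<lambda>a. f (gl_mult a b)) \<in> dual" by (rule dual_compose[OF fd linear_gl_mult_left])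
    have "f (gl_mult (a - (\<Sum>x\<in>B. scale (c x a) x)) b) = 0"
      using B(4) I(1,3) by (simp add: two_sided_ideal_def)
    then have "f (gl_mult a b) = (\<Sum>x\<in>B. c x a * f (gl_mult x b))"
      by (simp add: dual_diff[OF lin] dual_lincomb[OF lin])
    also have "\<dots> = (\<Sum>i<card B. c (h i) a * f (gl_mult (h i) b))"
      by (rule sum.reindex_bij_betw[OF h, symmetric])
    finally show "f (gl_mult a b) = (\<Sum>i<card B. c (h i) a * f (gl_mult (h i) b))" .
  qed
qed
section \<open>Independence of the product from the choice of representatives\<close>

lemma vertices_LNode: "vertices (LNode v C) = insert v (\<Union>c\<in>set_mset C. vertices c)"
  by (auto simp: vertices_def)

lemma finite_vertices [simp]: "finite (vertices l)"
  by (simp add: vertices_def)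

lemma graft_cong:
  "(\<And>v. v \<in> vertices l \<Longrightarrow> g v = g' v) \<Longrightarrow> graft g l = graft g' l"
proof (induction l)
  case (LNode v C)
  then have "image_mset (graft g) C = image_mset (graft g') C"
    by (intro image_mset_cong) (auto simp: vertices_LNode)
  then show ?case using LNode.prems by (simp add: vertices_LNode)
qed

lemma graft_empty: "graft (\<lambda>_. {#}) l = shape l"
proof (induction l)
  case (LNode v C)
  then have "image_mset (graft (\<lambda>_. {#})) C = image_mset shape C" by (intro image_mset_cong)
  then show ?case by simp
qed

definition fvertices :: "'v ltree multiset \<Rightarrow> 'v set" where
  "fvertices C = (\<Union>c\<in>set_mset C. vertices c)"

text \<open>Names are counted over the whole forest, so its trees are also pairwise disjoint and
  none occurs twice.\<close>

definition distinct_forest :: "'v ltree multiset \<Rightarrow> bool" where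
  "distinct_forest C \<longleftrightarrow> (\<forall>v. count (\<Sum>\<^sub># (image_mset vertex_mset C)) v \<le> 1)"

lemma count_vertex_mset: "count (vertex_mset l) v = 0 \<longleftrightarrow> v \<notin> vertices l"
  by (simp add: vertices_def not_in_iff)

lemma count_forest: "count (\<Sum>\<^sub># (image_mset vertex_mset C)) v = 0 \<longleftrightarrow> v \<notin> fvertices C"
  by (induction C) (auto simp: fvertices_def count_vertex_mset not_in_iff)

lemma add_le_1_iff: "(a::nat) + b \<le> 1 \<longleftrightarrow> a \<le> 1 \<and> b \<le> 1 \<and> (a = 0 \<or> b = 0)"
  by auto

lemma distinct_forest_add_mset:
  "distinct_forest (add_mset c C) \<longleftrightarrow>
     distinct_names c \<and> distinct_forest C \<and> vertices c \<inter> fvertices C = {}"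
  unfolding distinct_forest_def distinct_names_def image_mset_add_mset sum_mset.add_mset
    count_union add_le_1_iff count_forest count_vertex_mset
  by blast

lemma distinct_names_LNode:
  "distinct_names (LNode v C) \<longleftrightarrow> v \<notin> fvertices C \<and> distinct_forest C"
proof -
  define X where "X = \<Sum>\<^sub># (image_mset vertex_mset C)"
  have "v \<notin> fvertices C \<longleftrightarrow> count X v = 0" by (simp only: X_def count_forest)
  moreover have "distinct_forest C \<longleftrightarrow> (\<forall>u. count X u \<le> 1)"
    by (simp only: X_def distinct_forest_def)
  moreover have "count (vertex_mset (LNode v C)) u = (if u = v then 1 else 0) + count X u" for u
    by (simp add: X_def)
  ultimately show ?thesis
    unfolding distinct_names_def by (simp only: add_le_1_iff) auto
qed

text \<open>The first premise is the induction hypothesis of \<open>relabel\<close> for the members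
  of \<open>C\<close>. The trees of the two forests are paired by shape, and the bijections of the
  pairs glue because the vertex sets within a forest are disjoint.\<close>

lemma relabel_forest:
  fixes C :: "'v ltree multiset" and C' :: "'w ltree multiset"
  assumes "\<And>c (c' :: 'w ltree). c \<in># C \<Longrightarrow> distinct_names c \<Longrightarrow> distinct_names c' \<Longrightarrow> shape c' = shape c \<Longrightarrow>
      \<exists>\<beta>. bij_betw \<beta> (vertices c) (vertices c') \<and> (\<forall>g. graft g c' = graft (g \<circ> \<beta>) c)"
    and "distinct_forest C" "distinct_forest C'" "image_mset shape C' = image_mset shape C"
  shows "\<exists>\<beta>. bij_betw \<beta> (fvertices C) (fvertices C') \<and>
      (\<forall>g. image_mset (graft g) C' = image_mset (graft (g \<circ> \<beta>)) C)"
  using assms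
proof (induction C arbitrary: C')
  case empty
  then show ?case by (simp add: fvertices_def bij_betw_def)
next
  case (add c C)
  from add.prems(4) obtain c' C1 where C': "C' = add_mset c' C1" "shape c' = shape c"
    "image_mset shape C1 = image_mset shape C"
    by (auto dest: msed_map_invR)
  have d: "distinct_names c" "distinct_forest C" "vertices c \<inter> fvertices C = {}"
    "distinct_names c'" "distinct_forest C1" "vertices c' \<inter> fvertices C1 = {}"
    using add.prems(2,3) by (auto simp: distinct_forest_add_mset C')
  obtain \<beta>1 where \<beta>1: "bij_betw \<beta>1 (vertices c) (vertices c')" "\<And>g. graft g c' = graft (g \<circ> \<beta>1) c"
  proof -
    have "\<exists>\<beta>. bij_betw \<beta> (vertices c) (vertices c') \<and> (\<forall>g. graft g c' = graft (g \<circ> \<beta>) c)"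
      by (rule add.prems(1)[OF _ d(1,4) C'(2)]) simp
    then show thesis using that by blast
  qed
  obtain \<beta>2 where \<beta>2: "bij_betw \<beta>2 (fvertices C) (fvertices C1)"
    "\<And>g. image_mset (graft g) C1 = image_mset (graft (g \<circ> \<beta>2)) C"
  proof -
    have "\<exists>\<beta>. bij_betw \<beta> (fvertices C) (fvertices C1) \<and>
        (\<forall>g. image_mset (graft g) C1 = image_mset (graft (g \<circ> \<beta>)) C)"
      by (rule add.IH[OF add.prems(1) d(2,5) C'(3)]) auto
    then show thesis using that by blast
  qed
  define \<beta> where "\<beta> v = (if v \<in> vertices c then \<beta>1 v else \<beta>2 v)" for v
  have "bij_betw \<beta> (vertices c) (vertices c')"
    using \<beta>1(1) by (subst bij_betw_cong[of _ _ \<beta>1]) (auto simp: \<beta>_def)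
  moreover have "bij_betw \<beta> (fvertices C) (fvertices C1)"
    using \<beta>2(1) d(3) by (subst bij_betw_cong[of _ _ \<beta>2]) (auto simp: \<beta>_def)
  ultimately have "bij_betw \<beta> (vertices c \<union> fvertices C) (vertices c' \<union> fvertices C1)"
    using d(6) by (rule bij_betw_combine)
  then have "bij_betw \<beta> (fvertices (add_mset c C)) (fvertices C')"
    by (simp add: fvertices_def C')
  moreover have "image_mset (graft g) C' = image_mset (graft (g \<circ> \<beta>)) (add_mset c C)" for g
  proof -
    have "graft (g \<circ> \<beta>1) c = graft (g \<circ> \<beta>) c"
      by (rule graft_cong) (simp add: \<beta>_def)
    moreover have "image_mset (graft (g \<circ> \<beta>2)) C = image_mset (graft (g \<circ> \<beta>)) C"
      using d(3) by (intro image_mset_cong graft_cong) (auto simp: \<beta>_def fvertices_def)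
    ultimately show ?thesis by (simp add: C'(1) \<beta>1(2) \<beta>2(2))
  qed
  ultimately show ?case by blast
qed

text \<open>\<open>named\<close> picks an arbitrary copy of a tree, and this lemma serves to remove
  that choice from the product. The renaming matches the roots and then the forests below
  them.\<close>

lemma relabel:
  assumes "distinct_names l" "distinct_names l'" "shape l' = shape l"
  shows "\<exists>\<beta>. bij_betw \<beta> (vertices l) (vertices l') \<and> (\<forall>g. graft g l' = graft (g \<circ> \<beta>) l)"
  using assms
proof (induction l arbitrary: l')
  case (LNode v C)
  obtain v' C' where l': "l' = LNode v' C'" by (cases l')
  have d: "v \<notin> fvertices C" "distinct_forest C" "v' \<notin> fvertices C'" "distinct_forest C'"
    and sh: "image_mset shape C' = image_mset shape C"
    using LNode.prems by (auto simp: l' distinct_names_LNode)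
  obtain \<beta>1 where \<beta>1: "bij_betw \<beta>1 (fvertices C) (fvertices C')"
    "\<And>g. image_mset (graft g) C' = image_mset (graft (g \<circ> \<beta>1)) C"
    using relabel_forest[OF LNode.IH d(2,4) sh] by blast
  \<comment> \<open>Redirecting \<open>v\<close> leaves \<open>\<beta>1\<close> intact on the
    forest, where \<open>v\<close> does not occur.\<close>
  define \<beta> where "\<beta> = \<beta>1(v := v')"
  have "bij_betw \<beta> (fvertices C) (fvertices C')"
    using \<beta>1(1) d(1) by (subst bij_betw_cong[of _ _ \<beta>1]) (auto simp: \<beta>_def)
  moreover have "bij_betw \<beta> {v} {v'}" by (simp add: \<beta>_def bij_betw_def)
  ultimately have "bij_betw \<beta> ({v} \<union> fvertices C) ({v'} \<union> fvertices C')"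
    using d(3) by (intro bij_betw_combine) auto
  then have "bij_betw \<beta> (vertices (LNode v C)) (vertices l')"
    by (simp add: l' vertices_LNode fvertices_def)
  moreover have "graft g l' = graft (g \<circ> \<beta>) (LNode v C)" for g
  proof -
    have "image_mset (graft (g \<circ> \<beta>1)) C = image_mset (graft (g \<circ> \<beta>)) C"
      using d(1) by (intro image_mset_cong graft_cong) (auto simp: \<beta>_def fvertices_def)
    then show ?thesis by (simp add: l' \<beta>1(2)) (simp add: \<beta>_def)
  qed
  ultimately show ?case by blast
qed

text \<open>Any bijection \<open>h\<close> lets both families be indexed by \<open>R\<close>; having
  the same image multiset, they then differ by a permutation \<open>p\<close> of \<open>R\<close>,
  which is composed with \<open>h\<close>.\<close>

lemma image_mset_eq_imp_bij_betw:
  assumes "finite R" "finite R'" "image_mset \<sigma> (mset_set R) = image_mset \<sigma>' (mset_set R')"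
  shows "\<exists>\<gamma>. bij_betw \<gamma> R R' \<and> (\<forall>r\<in>R. \<sigma> r = \<sigma>' (\<gamma> r))"
proof -
  have "card R = card R'"
    using arg_cong[OF assms(3), of size] by simp
  then obtain h where h: "bij_betw h R R'"
    using finite_same_card_bij[OF assms(1,2)] by blast
  have "image_mset \<sigma> (mset_set R) = image_mset (\<sigma>' \<circ> h) (mset_set R)"
    using h assms(3)
    by (metis bij_betw_def image_mset_mset_set multiset.map_comp)
  then obtain p where p: "p permutes R" "\<forall>r\<in>R. \<sigma> r = (\<sigma>' \<circ> h) (p r)"
    using image_mset_eq_implies_permutes[OF assms(1)] by blast
  have "bij_betw (h \<circ> p) R R'"
    using bij_betw_trans[OF permutes_imp_bij[OF p(1)] h] .
  then show ?thesis using p(2) by (intro exI[of _ "h \<circ> p"]) simp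
qed

text \<open>The formula for the product of trees with its two choices left open: an arbitrary index
  set for the subtrees at the root of the left factor and an arbitrary named copy of the right
  factor.\<close>

definition graft_sum :: "'i set \<Rightarrow> ('i \<Rightarrow> rtree) \<Rightarrow> 'v ltree \<Rightarrow> 'k::field gl" where
  "graft_sum R \<sigma> l = (\<Sum>\<phi>\<in>R \<rightarrow>\<^sub>E vertices l.
     basis (graft (\<lambda>v. image_mset \<sigma> (mset_set {r \<in> R. \<phi> r = v})) l))"

text \<open>Attaching maps correspond by composition with the renaming of the vertices.\<close>

lemma graft_sum_relabel:
  assumes "distinct_names l" "distinct_names l'" "shape l' = shape l"
  shows "graft_sum R \<sigma> l' = (graft_sum R \<sigma> l :: 'k::field gl)"
proof -
  obtain \<beta> where \<beta>: "bij_betw \<beta> (vertices l) (vertices l')" "\<And>g. graft g l' = graft (g \<circ> \<beta>) l"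
    using relabel[OF assms] by blast
  have inj: "\<beta> u = \<beta> v \<longleftrightarrow> u = v" if "u \<in> vertices l" "v \<in> vertices l" for u v
    using \<beta>(1) that by (auto simp: bij_betw_def inj_on_def)
  define \<beta>' where "\<beta>' = the_inv_into (vertices l) \<beta>"
  have b1: "\<beta>' (\<beta> v) = v" "\<beta> v \<in> vertices l'" if "v \<in> vertices l" for v
    using \<beta>(1) that by (auto simp: \<beta>'_def bij_betw_def the_inv_into_f_f)
  have b2: "\<beta> (\<beta>' v) = v" "\<beta>' v \<in> vertices l" if "v \<in> vertices l'" for v
    using \<beta>(1) that f_the_inv_into_f_bij_betw[OF \<beta>(1)]
    by (auto simp: \<beta>'_def bij_betw_def intro: the_inv_into_into)
  show ?thesis
    unfolding graft_sum_def
  proof (rule sum.reindex_bij_witness[where i = "\<lambda>\<phi>. \<lambda>r\<in>R. \<beta> (\<phi> r)" and j = "\<lambda>\<phi>. \<lambda>r\<in>R. \<beta>' (\<phi> r)"])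
    fix \<phi> assume \<phi>: "\<phi> \<in> R \<rightarrow>\<^sub>E vertices l'"
    have "graft (\<lambda>v. image_mset \<sigma> (mset_set {r \<in> R. (\<lambda>r\<in>R. \<beta>' (\<phi> r)) r = v})) l =
        graft ((\<lambda>v. image_mset \<sigma> (mset_set {r \<in> R. \<phi> r = v})) \<circ> \<beta>) l"
    proof (rule graft_cong)
      fix v assume v: "v \<in> vertices l"
      have "{r \<in> R. (\<lambda>r\<in>R. \<beta>' (\<phi> r)) r = v} = {r \<in> R. \<phi> r = \<beta> v}"
        using \<phi> v b1 b2 by (auto simp: PiE_iff)
      then show "image_mset \<sigma> (mset_set {r \<in> R. (\<lambda>r\<in>R. \<beta>' (\<phi> r)) r = v}) =
          ((\<lambda>v. image_mset \<sigma> (mset_set {r \<in> R. \<phi> r = v})) \<circ> \<beta>) v" by simp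
    qed
    then show "basis (graft (\<lambda>v. image_mset \<sigma> (mset_set {r \<in> R. (\<lambda>r\<in>R. \<beta>' (\<phi> r)) r = v})) l) =
        (basis (graft (\<lambda>v. image_mset \<sigma> (mset_set {r \<in> R. \<phi> r = v})) l') :: 'k gl)"
      by (simp add: \<beta>(2))
  qed (auto simp: b1 b2 PiE_iff extensional_def fun_eq_iff)
qed

text \<open>Attaching maps correspond by precomposition with a matching of the indices; the fibres
  over each vertex then carry the same multiset of subtrees.\<close>

lemma graft_sum_reindex:
  assumes "finite R" "finite R'" "image_mset \<sigma> (mset_set R) = image_mset \<sigma>' (mset_set R')"
  shows "graft_sum R' \<sigma>' l = (graft_sum R \<sigma> l :: 'k::field gl)"
proof -
  obtain \<gamma> where \<gamma>: "bij_betw \<gamma> R R'" "\<And>r. r \<in> R \<Longrightarrow> \<sigma> r = \<sigma>' (\<gamma> r)"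
    using image_mset_eq_imp_bij_betw[OF assms] by blast
  define \<delta> where "\<delta> = the_inv_into R \<gamma>"
  have b1: "\<delta> (\<gamma> r) = r" "\<gamma> r \<in> R'" if "r \<in> R" for r
    using \<gamma>(1) that by (auto simp: \<delta>_def bij_betw_def the_inv_into_f_f)
  have b2: "\<gamma> (\<delta> r) = r" "\<delta> r \<in> R" if "r \<in> R'" for r
    using \<gamma>(1) that f_the_inv_into_f_bij_betw[OF \<gamma>(1)]
    by (auto simp: \<delta>_def bij_betw_def intro: the_inv_into_into)
  show ?thesis
    unfolding graft_sum_def
  proof (rule sum.reindex_bij_witness[where i = "\<lambda>\<phi>. \<lambda>r\<in>R'. \<phi> (\<delta> r)" and j = "\<lambda>\<phi>. \<lambda>r\<in>R. \<phi> (\<gamma> r)"])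
    fix \<phi> assume \<phi>: "\<phi> \<in> R' \<rightarrow>\<^sub>E vertices l"
    have "image_mset \<sigma> (mset_set {r \<in> R. (\<lambda>r\<in>R. \<phi> (\<gamma> r)) r = v}) =
        image_mset \<sigma>' (mset_set {r \<in> R'. \<phi> r = v})" for v
    proof -
      have "image_mset \<sigma> (mset_set {r \<in> R. (\<lambda>r\<in>R. \<phi> (\<gamma> r)) r = v}) =
          image_mset \<sigma>' (image_mset \<gamma> (mset_set {r \<in> R. \<phi> (\<gamma> r) = v}))"
      proof -
        have "{r \<in> R. (\<lambda>r\<in>R. \<phi> (\<gamma> r)) r = v} = {r \<in> R. \<phi> (\<gamma> r) = v}" by auto
        moreover have "image_mset \<sigma> (mset_set {r \<in> R. \<phi> (\<gamma> r) = v}) =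
            image_mset (\<sigma>' \<circ> \<gamma>) (mset_set {r \<in> R. \<phi> (\<gamma> r) = v})"
          using assms(1) by (intro image_mset_cong) (auto simp: \<gamma>(2))
        ultimately show ?thesis by (simp add: multiset.map_comp)
      qed
      also have "inj_on \<gamma> {r \<in> R. \<phi> (\<gamma> r) = v}"
        using \<gamma>(1) by (auto simp: bij_betw_def inj_on_def)
      then have "image_mset \<gamma> (mset_set {r \<in> R. \<phi> (\<gamma> r) = v}) = mset_set (\<gamma> ` {r \<in> R. \<phi> (\<gamma> r) = v})"
        by (rule image_mset_mset_set)
      also have "\<gamma> ` {r \<in> R. \<phi> (\<gamma> r) = v} = {r \<in> R'. \<phi> r = v}"
        using b1 b2 by force
      finally show ?thesis .
    qed
    then show "basis (graft (\<lambda>v. image_mset \<sigma> (mset_set {r \<in> R. (\<lambda>r\<in>R. \<phi> (\<gamma> r)) r = v})) l) =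
        (basis (graft (\<lambda>v. image_mset \<sigma>' (mset_set {r \<in> R'. \<phi> r = v})) l) :: 'k gl)"
      by simp
  qed (auto simp: b1 b2 PiE_iff extensional_def fun_eq_iff)
qed

text \<open>This allows products to be computed with whatever index set and vertex names suit the
  argument.\<close>

lemma tree_mult_eq_graft_sum:
  assumes "finite R" "distinct_names l"
  shows "tree_mult (Node (image_mset \<sigma> (mset_set R))) (shape l) = (graft_sum R \<sigma> l :: 'k::field gl)"
proof -
  let ?s = "Node (image_mset \<sigma> (mset_set R))"
  have "image_mset shape (mset_set (root_children ?s)) = image_mset \<sigma> (mset_set R)"
    using Node_subtrees_of_root_children[of ?s] by (simp add: subtrees_of_def)
  then have "graft_sum (root_children ?s) shape (named (shape l)) =
      (graft_sum R \<sigma> (named (shape l)) :: 'k gl)"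
    by (intro graft_sum_reindex) (simp_all add: assms(1))
  also have "\<dots> = graft_sum R \<sigma> l"
    by (rule graft_sum_relabel) (simp_all add: assms(2) distinct_names_named)
  finally have "graft_sum (root_children ?s) shape (named (shape l)) =
      (graft_sum R \<sigma> l :: 'k gl)" .
  then show ?thesis by (simp add: tree_mult_def graft_sum_def subtrees_of_def)
qed

section \<open>Associativity for right multiplication by the two-vertex tree\<close>

lemma image_mset_mset_set_Plus:
  assumes "finite X" "finite Y"
  shows "image_mset (case_sum f g) (mset_set (X <+> Y)) =
    image_mset f (mset_set X) + image_mset g (mset_set Y)"
proof -
  have "mset_set (X <+> Y) = image_mset Inl (mset_set X) + image_mset Inr (mset_set Y)"
    unfolding Plus_def using assms
    by (subst mset_set_Union) (auto simp: image_mset_mset_set)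
  then show ?thesis by (simp add: multiset.map_comp comp_def)
qed

text \<open>An attaching map into a two-vertex tree amounts to a subset \<open>P\<close> of
  \<open>R\<close>, the subtrees sent to the vertex other than the root.\<close>

lemma tree_mult_N_e:
  assumes "finite R"
  shows "tree_mult (Node (image_mset \<sigma> (mset_set R))) N_e =
    (\<Sum>P\<in>Pow R. basis (Node (add_mset (Node (image_mset \<sigma> (mset_set P)))
       (image_mset \<sigma> (mset_set (R - P))))) :: 'k::field gl)"
proof -
  \<comment> \<open>With booleans as names, \<open>True\<close> for the vertex other than the root,
    attaching maps are predicates on \<open>R\<close>.\<close>
  define l where "l = LNode False {#LNode True {#}#}"
  have V: "vertices l = UNIV" by (auto simp: l_def vertices_LNode)
  have "distinct_names l" by (simp add: l_def distinct_names_def)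
  moreover have "shape l = N_e" by (simp add: l_def N_e_def e_tree_def)
  ultimately have "tree_mult (Node (image_mset \<sigma> (mset_set R))) N_e = (graft_sum R \<sigma> l :: 'k gl)"
    using tree_mult_eq_graft_sum[OF assms] by metis
  also have "\<dots> = (\<Sum>P\<in>Pow R. basis (Node (add_mset (Node (image_mset \<sigma> (mset_set P)))
       (image_mset \<sigma> (mset_set (R - P))))))"
    unfolding graft_sum_def
  proof (rule sum.reindex_bij_witness[where i = "\<lambda>P. \<lambda>r\<in>R. r \<in> P" and j = "\<lambda>\<phi>. {r \<in> R. \<phi> r}"])
    fix \<phi> :: "'a \<Rightarrow> bool"
    have "{r \<in> R. \<phi> r = True} = {r \<in> R. \<phi> r}" "{r \<in> R. \<phi> r = False} = R - {r \<in> R. \<phi> r}" by auto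
    then show "basis (Node (add_mset (Node (image_mset \<sigma> (mset_set {r \<in> R. \<phi> r})))
         (image_mset \<sigma> (mset_set (R - {r \<in> R. \<phi> r}))))) =
       (basis (graft (\<lambda>v. image_mset \<sigma> (mset_set {r \<in> R. \<phi> r = v})) l) :: 'k gl)"
      by (simp add: l_def)
  qed (auto simp: V PiE_iff extensional_def fun_eq_iff)
  finally show ?thesis .
qed

text \<open>The root of a grafted tree has children of two kinds, the attached ones and the original
  ones. Indexing them by a disjoint sum turns each subset into a pair of subsets.\<close>

lemma tree_mult_N_e_Plus:
  assumes "finite X" "finite Y"
  shows "tree_mult (Node (image_mset f (mset_set X) + image_mset g (mset_set Y))) N_e =
    (\<Sum>P\<in>Pow X. \<Sum>S\<in>Pow Y. basis (Node (add_mset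
       (Node (image_mset f (mset_set P) + image_mset g (mset_set S)))
       (image_mset f (mset_set (X - P)) + image_mset g (mset_set (Y - S))))) :: 'k::field gl)"
proof -
  let ?h = "\<lambda>Q. image_mset (case_sum f g) (mset_set Q)"
  have "tree_mult (Node (?h (X <+> Y))) N_e =
      (\<Sum>Q\<in>Pow (X <+> Y). basis (Node (add_mset (Node (?h Q)) (?h ((X <+> Y) - Q)))) :: 'k gl)"
    by (rule tree_mult_N_e) (simp add: assms)
  also have "\<dots> = (\<Sum>(P, S)\<in>Pow X \<times> Pow Y.
      basis (Node (add_mset (Node (?h (P <+> S))) (?h ((X - P) <+> (Y - S))))))"
  proof (rule sum.reindex_bij_witness[where i = "\<lambda>(P, S). P <+> S"
        and j = "\<lambda>Q. (Inl -` Q, Inr -` Q)"])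
    fix Q assume "Q \<in> Pow (X <+> Y)"
    have "x \<in> Inl -` Q <+> Inr -` Q \<longleftrightarrow> x \<in> Q" for x by (cases x) auto
    then have "Inl -` Q <+> Inr -` Q = Q" by blast
    moreover have "x \<in> (X - Inl -` Q) <+> (Y - Inr -` Q) \<longleftrightarrow> x \<in> (X <+> Y) - Q" for x
      by (cases x) auto
    then have "(X - Inl -` Q) <+> (Y - Inr -` Q) = (X <+> Y) - Q" by blast
    ultimately show "(case (Inl -` Q, Inr -` Q) of (P, S) \<Rightarrow> P <+> S) = Q"
      "(case (Inl -` Q, Inr -` Q) of (P, S) \<Rightarrow>
          basis (Node (add_mset (Node (?h (P <+> S))) (?h ((X - P) <+> (Y - S)))))) =
        (basis (Node (add_mset (Node (?h Q)) (?h ((X <+> Y) - Q)))) :: 'k gl)"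
      by auto
  qed auto
  also have "\<dots> = (\<Sum>(P, S)\<in>Pow X \<times> Pow Y. basis (Node (add_mset
       (Node (image_mset f (mset_set P) + image_mset g (mset_set S)))
       (image_mset f (mset_set (X - P)) + image_mset g (mset_set (Y - S))))))"
    using assms
    by (intro sum.cong refl) (auto simp: image_mset_mset_set_Plus finite_subset)
  finally show ?thesis
    using assms by (simp add: image_mset_mset_set_Plus sum.cartesian_product)
qed

lemma gl_mult_sum_left: "gl_mult (\<Sum>x\<in>X. a x) b = (\<Sum>x\<in>X. gl_mult (a x) b)"
  by (simp add: gl_mult_lin_ext lin_ext_sum)

lemma gl_mult_sum_right: "gl_mult a (\<Sum>x\<in>X. b x) = (\<Sum>x\<in>X. gl_mult a (b x))"
proof -
  interpret Vector_Spaces.linear scale scale "gl_mult a" by (rule linear_gl_mult_right)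
  show ?thesis by (rule sum)
qed

text \<open>Both sides expand to the sum of the trees \<open>T \<phi> P S\<close>:
  \<open>\<phi>\<close> attaches the root subtrees of \<open>s\<close> to \<open>t\<close>, while
  \<open>P\<close> and \<open>S\<close> select the attached and the original children of the root
  that move to the new vertex.\<close>

lemma tree_assoc_N_e:
  "gl_mult (tree_mult s t) (basis N_e) = (gl_mult (basis s) (tree_mult t N_e) :: 'k::field gl)"
proof -
  define R where "R = root_children s"
  obtain v C where l: "named t = LNode v C" by (cases "named t")
  define D where "D = set_mset C"
  have C: "C = mset_set D"
    using distinct_names_children[OF distinct_names_named[of t]] by (simp add: l D_def)
  define l where "l = LNode v (mset_set D)"
  have nl: "named t = l" by (simp add: l l_def C)
  have fin: "finite R" "finite D" by (simp_all add: R_def D_def)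
  have dl: "distinct_names l" using distinct_names_named[of t] by (simp add: nl)
  define V where "V = vertices l"
  \<comment> \<open>A fresh name for the vertex that multiplication by \<open>N_e\<close> adds to
    \<open>t\<close>.\<close>
  obtain w where w: "w \<notin> V"
    using ex_new_if_finite[OF infinite_UNIV_nat, of V] by (auto simp: V_def)
  have vV: "v \<in> V" and v: "v \<notin> fvertices (mset_set D)"
    using dl by (auto simp: V_def l_def vertices_LNode distinct_names_LNode)
  have DV: "vertices c \<subseteq> V - {v}" if "c \<in> D" for c
    using that v fin by (auto simp: V_def l_def vertices_LNode fvertices_def)
  have t: "t = Node (image_mset shape (mset_set D))" using shape_named[of t] by (simp add: nl l_def)
  have s: "Node (image_mset shape (mset_set R)) = s"
    using Node_subtrees_of_root_children[of s] by (simp add: R_def subtrees_of_def)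
  define G :: "(nat ltree \<Rightarrow> nat) \<Rightarrow> nat \<Rightarrow> rtree multiset"
    where "G \<phi> u = image_mset shape (mset_set {r \<in> R. \<phi> r = u})" for \<phi> u
  have G_fun: "G \<phi> = (\<lambda>u. image_mset shape (mset_set {r \<in> R. \<phi> r = u}))" for \<phi>
    by (rule ext) (rule G_def)
  define T where "T \<phi> P S = Node (add_mset
      (Node (image_mset shape (mset_set P) + image_mset (graft (G \<phi>)) (mset_set S)))
      (image_mset shape (mset_set ({r \<in> R. \<phi> r = v} - P)) +
        image_mset (graft (G \<phi>)) (mset_set (D - S))))" for \<phi> P S
  \<comment> \<open>\<open>l' S\<close> represents the term of \<open>t x\<close> in which the children in \<open>S\<close> are moved to
    the new vertex \<open>w\<close>. A map \<open>\<psi>\<close> from \<open>R\<close> to its vertices amounts to a map \<open>\<phi>\<close> from \<open>R\<close>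
    to \<open>V\<close> and the subset \<open>P\<close> of the fibre of \<open>\<phi>\<close> over the root that \<open>\<psi>\<close> sends to \<open>w\<close>.\<close>
  define l' where "l' S = LNode v (add_mset (LNode w (mset_set S)) (mset_set (D - S)))" for S
  \<comment> \<open>The children are only shared out between \<open>v\<close> and \<open>w\<close>,
    so the vertices of \<open>l' S\<close> do not depend on \<open>S\<close>.\<close>
  have part: "mset_set D = mset_set S + mset_set (D - S)" if "S \<subseteq> D" for S
  proof -
    have "mset_set (S \<union> (D - S)) = mset_set S + mset_set (D - S)"
      using that fin by (intro mset_set_Union) (auto dest: finite_subset)
    moreover have "S \<union> (D - S) = D" using that by blast
    ultimately show ?thesis by simp
  qed
  have l': "distinct_names (l' S)" "vertices (l' S) = insert w V" if "S \<subseteq> D" for S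
  proof -
    have vm: "vertex_mset (l' S) = add_mset w (vertex_mset l)"
      by (simp add: l'_def l_def part[OF that])
    then show "vertices (l' S) = insert w V" by (simp add: vertices_def V_def)
    have "count (vertex_mset l) w = 0" using w by (simp only: V_def count_vertex_mset not_False_eq_True)
    then show "distinct_names (l' S)"
      using dl by (simp add: distinct_names_def vm)
  qed
  have shape_l': "shape (l' S) = Node (add_mset (Node (image_mset shape (mset_set S)))
      (image_mset shape (mset_set (D - S))))" for S
    by (simp add: l'_def)
  have inner: "(\<Sum>\<psi>\<in>R \<rightarrow>\<^sub>E insert w V. basis (graft (G \<psi>) (l' S))) =
      (\<Sum>\<phi>\<in>R \<rightarrow>\<^sub>E V. \<Sum>P\<in>Pow {r \<in> R. \<phi> r = v}. basis (T \<phi> P S) :: 'k gl)" if S: "S \<subseteq> D" for S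
  proof -
    have "(\<Sum>\<psi>\<in>R \<rightarrow>\<^sub>E insert w V. basis (graft (G \<psi>) (l' S))) =
      (\<Sum>(\<phi>, P)\<in>(SIGMA \<phi>:R \<rightarrow>\<^sub>E V. Pow {r \<in> R. \<phi> r = v}). basis (T \<phi> P S) :: 'k gl)"
    proof (rule sum.reindex_bij_witness[
          where i = "\<lambda>(\<phi>, P). \<lambda>r\<in>R. if r \<in> P then w else \<phi> r"
          and j = "\<lambda>\<psi>. (\<lambda>r\<in>R. if \<psi> r = w then v else \<psi> r, {r \<in> R. \<psi> r = w})"])
      fix \<psi> assume \<psi>: "\<psi> \<in> R \<rightarrow>\<^sub>E insert w V"
      \<comment> \<open>\<open>\<phi>\<close> folds \<open>w\<close> back into the root: its fibre
        over \<open>v\<close> merges the fibres of \<open>\<psi>\<close> over \<open>v\<close> and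
        \<open>w\<close>, and the fibres over the other vertices of \<open>V\<close> are
        unchanged.\<close>
      define \<phi> where "\<phi> = (\<lambda>r\<in>R. if \<psi> r = w then v else \<psi> r)"
      have Gw: "G \<psi> w = image_mset shape (mset_set {r \<in> R. \<psi> r = w})" by (simp add: G_def)
      have "{r \<in> R. \<psi> r = v} = {r \<in> R. \<phi> r = v} - {r \<in> R. \<psi> r = w}"
        using vV w by (auto simp: \<phi>_def)
      then have Gv: "G \<psi> v = image_mset shape (mset_set ({r \<in> R. \<phi> r = v} - {r \<in> R. \<psi> r = w}))"
        by (simp add: G_def)
      have "G \<psi> u = G \<phi> u" if "u \<in> V - {v}" for u
      proof -
        have "{r \<in> R. \<psi> r = u} = {r \<in> R. \<phi> r = u}" using that w by (auto simp: \<phi>_def)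
        then show ?thesis by (simp add: G_def)
      qed
      then have Gc: "graft (G \<psi>) c = graft (G \<phi>) c" if "c \<in> D" for c
        using DV[OF that] by (intro graft_cong) auto
      have "image_mset (graft (G \<psi>)) (mset_set Q) = image_mset (graft (G \<phi>)) (mset_set Q)"
        if "Q \<subseteq> D" for Q
        using that finite_subset[OF that fin(2)] by (intro image_mset_cong Gc) auto
      then have "graft (G \<psi>) (l' S) = T \<phi> {r \<in> R. \<psi> r = w} S"
        using S by (simp add: l'_def T_def Gw Gv add.commute)
      then show "(case (\<lambda>r\<in>R. if \<psi> r = w then v else \<psi> r, {r \<in> R. \<psi> r = w}) of
          (\<phi>, P) \<Rightarrow> basis (T \<phi> P S)) = (basis (graft (G \<psi>) (l' S)) :: 'k gl)"
        by (simp add: \<phi>_def)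
    next
      fix y assume "y \<in> (SIGMA \<phi>:R \<rightarrow>\<^sub>E V. Pow {r \<in> R. \<phi> r = v})"
      then show "((\<lambda>r\<in>R. if (case y of (\<phi>, P) \<Rightarrow> \<lambda>r\<in>R. if r \<in> P then w else \<phi> r) r = w then v
            else (case y of (\<phi>, P) \<Rightarrow> \<lambda>r\<in>R. if r \<in> P then w else \<phi> r) r),
          {r \<in> R. (case y of (\<phi>, P) \<Rightarrow> \<lambda>r\<in>R. if r \<in> P then w else \<phi> r) r = w}) = y"
        using w by (auto simp: PiE_iff extensional_def fun_eq_iff split: if_splits)
    qed (use vV in \<open>auto simp: PiE_iff extensional_def fun_eq_iff split: if_splits\<close>)
    also have "\<dots> = (\<Sum>\<phi>\<in>R \<rightarrow>\<^sub>E V. \<Sum>P\<in>Pow {r \<in> R. \<phi> r = v}. basis (T \<phi> P S))"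
      using fin by (intro sum.Sigma[symmetric] finite_PiE) (auto simp: V_def)
    finally show ?thesis .
  qed
  have "gl_mult (tree_mult s t) (basis N_e) =
      (\<Sum>\<phi>\<in>R \<rightarrow>\<^sub>E V. tree_mult (graft (G \<phi>) l) N_e :: 'k gl)"
    by (simp add: tree_mult_def subtrees_of_def gl_mult_sum_left R_def V_def nl G_fun)
  also have "\<dots> = (\<Sum>\<phi>\<in>R \<rightarrow>\<^sub>E V. \<Sum>P\<in>Pow {r \<in> R. \<phi> r = v}. \<Sum>S\<in>Pow D. basis (T \<phi> P S))"
  proof (rule sum.cong)
    fix \<phi>
    have "graft (G \<phi>) l = Node (image_mset shape (mset_set {r \<in> R. \<phi> r = v}) +
        image_mset (graft (G \<phi>)) (mset_set D))" by (simp add: l_def G_def)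
    then show "tree_mult (graft (G \<phi>) l) N_e =
        (\<Sum>P\<in>Pow {r \<in> R. \<phi> r = v}. \<Sum>S\<in>Pow D. basis (T \<phi> P S) :: 'k gl)"
      using fin by (simp only: T_def) (rule tree_mult_N_e_Plus, simp_all)
  qed simp
  \<comment> \<open>\<open>D\<close> depends neither on \<open>\<phi>\<close> nor on
    \<open>P\<close>, so the sum over \<open>S\<close> can move outermost; for each \<open>S\<close>
    the rest is the product of \<open>s\<close> with \<open>shape (l' S)\<close>.\<close>
  also have "\<dots> = (\<Sum>\<phi>\<in>R \<rightarrow>\<^sub>E V. \<Sum>S\<in>Pow D. \<Sum>P\<in>Pow {r \<in> R. \<phi> r = v}. basis (T \<phi> P S))"
    by (intro sum.cong refl sum.swap)
  also have "\<dots> = (\<Sum>S\<in>Pow D. \<Sum>\<phi>\<in>R \<rightarrow>\<^sub>E V. \<Sum>P\<in>Pow {r \<in> R. \<phi> r = v}. basis (T \<phi> P S))"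
    by (rule sum.swap)
  also have "\<dots> = (\<Sum>S\<in>Pow D. tree_mult s (shape (l' S)))"
  proof (rule sum.cong)
    fix S assume "S \<in> Pow D"
    then have S: "S \<subseteq> D" by simp
    have "tree_mult s (shape (l' S)) = (graft_sum R shape (l' S) :: 'k gl)"
      using tree_mult_eq_graft_sum[OF fin(1) l'(1)[OF S], of shape] by (simp add: s)
    also have "\<dots> = (\<Sum>\<psi>\<in>R \<rightarrow>\<^sub>E insert w V. basis (graft (G \<psi>) (l' S)))"
      by (simp add: graft_sum_def l'(2)[OF S] G_fun)
    finally show "(\<Sum>\<phi>\<in>R \<rightarrow>\<^sub>E V. \<Sum>P\<in>Pow {r \<in> R. \<phi> r = v}. basis (T \<phi> P S)) =
        (tree_mult s (shape (l' S)) :: 'k gl)"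
      by (simp add: inner[OF S])
  qed simp
  also have "\<dots> = gl_mult (basis s) (\<Sum>S\<in>Pow D. basis (shape (l' S)))"
    by (simp add: gl_mult_sum_right)
  also have "(\<Sum>S\<in>Pow D. basis (shape (l' S))) = (tree_mult t N_e :: 'k gl)"
    unfolding shape_l' by (subst t) (rule tree_mult_N_e[OF fin(2), symmetric])
  finally show ?thesis .
qed

section \<open>The counit\<close>

lemma root_children_eq_empty_iff: "root_children t = {} \<longleftrightarrow> t = e_tree"
  using Node_subtrees_of_eq_e[of "root_children t"] by simp

lemma tree_mult_e_tree: "tree_mult e_tree t = basis t"
proof -
  have "root_children e_tree = {}" by (simp add: root_children_eq_empty_iff)
  then show ?thesis by (simp add: tree_mult_def subtrees_of_def graft_empty)
qed

lemma gl_counit_dual: "gl_counit \<in> dual"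
  by (rule dualI) (simp_all add: gl_counit_def lookup_add)

text \<open>A graft is the one-vertex tree only if \<open>t\<close> has just its root and nothing is
  attached there. Every attaching map then sends all of \<open>root_children s\<close> to that root,
  so there can be no such children.\<close>

lemma gl_counit_tree_mult:
  "gl_counit (tree_mult s t :: 'k::field gl) = (if s = e_tree \<and> t = e_tree then 1 else 0)"
proof (cases "s = e_tree")
  case True
  then show ?thesis by (simp add: tree_mult_e_tree gl_counit_basis)
next
  case False
  then have R: "root_children s \<noteq> {}" by (simp add: root_children_eq_empty_iff)
  obtain v C where l: "named t = LNode v C" by (cases "named t")
  have "graft (\<lambda>v. subtrees_of {r \<in> root_children s. \<phi> r = v}) (named t) \<noteq> e_tree"
    if \<phi>: "\<phi> \<in> root_children s \<rightarrow>\<^sub>E vertices (named t)" for \<phi>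
  proof
    assume "graft (\<lambda>v. subtrees_of {r \<in> root_children s. \<phi> r = v}) (named t) = e_tree"
    then have "{r \<in> root_children s. \<phi> r = v} = {}" "C = {#}"
      by (auto simp: l e_tree_def subtrees_of_def mset_set_empty_iff)
    moreover from this have "vertices (named t) = {v}" by (simp add: l vertices_LNode)
    ultimately show False using \<phi> R by (auto simp: PiE_iff)
  qed
  then show ?thesis
    using False by (simp add: tree_mult_def dual_lincomb(1)[OF gl_counit_dual] gl_counit_basis)
qed

lemma gl_counit_mult: "gl_counit (gl_mult a b) = gl_counit a * gl_counit b"
proof -
  have *: "(\<Sum>t\<in>Poly_Mapping.keys c. Poly_Mapping.lookup c t * (if t = e_tree then x else 0)) =
      gl_counit c * x" for c :: "'a gl" and x
    by (cases "e_tree \<in> Poly_Mapping.keys c")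
      (auto simp: gl_counit_def in_keys_iff if_distrib[of "(*) _"] cong: if_cong)
  have "gl_counit (lin_ext (tree_mult s) b :: 'a gl) = (if s = e_tree then gl_counit b else 0)" for s
    using *[of b 1] by (simp add: dual_lin_ext[OF gl_counit_dual] gl_counit_tree_mult)
  then show ?thesis
    by (simp add: gl_mult_lin_ext dual_lin_ext[OF gl_counit_dual] *)
qed

text \<open>The kernel of the counit is an ideal by multiplicativity, and it is cofinite as the
  kernel of one functional.\<close>

lemma gl_counit_finite_dual: "gl_counit \<in> (finite_dual :: ('k::field gl \<Rightarrow> 'k) set)"
proof -
  let ?I = "{a :: 'k gl. gl_counit a = 0}"
  have "finite_codim (UNIV :: 'k gl set)" by (auto simp: finite_codim_def)
  then have "finite_codim ?I"
    using finite_codim_Int_kernel[OF _ _ gl_counit_dual, of UNIV] by simp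
  moreover have "two_sided_ideal ?I"
    using subspace_kernel[OF gl_counit_dual] by (simp add: two_sided_ideal_def gl_counit_mult)
  ultimately show ?thesis
    using gl_counit_dual unfolding finite_dual_def by blast
qed

section \<open>The Hochschild equation\<close>

text \<open>The ideal that serves for \<open>f\<close> also serves here, because it absorbs
  multiplication by \<open>b\<close> on the right.\<close>

lemma finite_dual_gl_mult_right:
  assumes "f \<in> finite_dual"
  shows "(\<lambda>a. f (gl_mult a b)) \<in> finite_dual"
  using assms dual_compose[OF _ linear_gl_mult_left]
  unfolding finite_dual_def two_sided_ideal_def by blast

text \<open>Both sides are linear in their argument, so agreement on pairs of trees
  suffices.\<close>

lemma dual_comult_eq_sum_dual_tensor:
  fixes n :: nat
  assumes "f \<in> dual" "\<And>s t. f (tree_mult s t) = (\<Sum>i<n. F i (basis s) * G i (basis t))"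
  shows "dual_comult f = (\<Sum>i<n. dual_tensor (F i) (G i))"
proof
  fix z
  have "dual_comult f z = (\<Sum>p\<in>Poly_Mapping.keys z. Poly_Mapping.lookup z p *
      (\<Sum>i<n. F i (basis (fst p)) * G i (basis (snd p))))"
    by (simp add: dual_comult_def transpose_map_def gl_mult_map_def dual_lin_ext[OF assms(1)]
        case_prod_beta assms(2))
  also have "\<dots> = (\<Sum>i<n. dual_tensor (F i) (G i) z)"
    unfolding dual_tensor_def by (subst sum.swap) (simp add: sum_distrib_left)
  also have "\<dots> = (\<Sum>i<n. dual_tensor (F i) (G i)) z"
    by (induction n) auto
  finally show "dual_comult f z = (\<Sum>i<n. dual_tensor (F i) (G i)) z" .
qed

theorem mainTheorem5:
  fixes M :: "'k::field_char_0 gl \<Rightarrow> 'k gl"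
  assumes "Vector_Spaces.linear scale scale M"
    and "M gl_unit = 0"
    and "\<And>t. t \<noteq> e_tree \<Longrightarrow> M (basis t) = gl_mult (basis t) (basis N_e)"
  shows "transpose_map M ` finite_dual \<subseteq> finite_dual \<and> hochschild_solution (transpose_map M)"
proof -
  let ?x = "basis N_e :: 'k gl"
  let ?L = "transpose_map M"
  \<comment> \<open>For \<open>t = e_tree\<close> the counit term cancels the product, which is
    \<open>?x\<close> itself; for every other tree it vanishes.\<close>
  have Mb: "M (basis t) = gl_mult (basis t) ?x - scale (gl_counit (basis t)) ?x" for t
    using assms(2,3) by (cases "t = e_tree") (simp_all add: gl_unit_def tree_mult_e_tree gl_counit_basis)
  have L_basis: "?L f (basis t) = f (gl_mult (basis t) ?x) - gl_counit (basis t) * f ?x"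
    if "f \<in> dual" for f t
    using that by (simp add: transpose_map_def Mb dual_diff dual_lincomb(2) del: gl_mult_basis)
  have L_dual: "?L f \<in> dual" if "f \<in> dual" for f
    using dual_compose[OF that assms(1)] by (simp add: transpose_map_def comp_def)
  \<comment> \<open>Both sides are linear functionals, so they are compared on trees. The right-hand
    side visibly lies in the finite dual if \<open>f\<close> does.\<close>
  have L_eq: "?L f = (\<lambda>a. f (gl_mult a ?x)) + (\<lambda>a. - f ?x * gl_counit a)" if f: "f \<in> dual" for f
  proof
    fix a :: "'k gl"
    let ?g = "(\<lambda>a. f (gl_mult a ?x)) + (\<lambda>a. - f ?x * gl_counit a)"
    have g: "?g \<in> dual"
    proof -
      note h = dual_compose[OF f linear_gl_mult_left[of ?x]]
      show ?thesis
        by (rule dualI) (simp_all add: dual_add[OF h] dual_lincomb(2)[OF h]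
            dual_add[OF gl_counit_dual] dual_lincomb(2)[OF gl_counit_dual] algebra_simps)
    qed
    have "h a = (\<Sum>t\<in>Poly_Mapping.keys a. Poly_Mapping.lookup a t * h (basis t))"
      if "h \<in> dual" for h
      using dual_lin_ext[OF that, of basis a] by (simp only: lin_ext_basis_id)
    from this[OF g] this[OF L_dual[OF f]] show "?L f a = ?g a"
      by (simp add: L_basis[OF f] mult.commute)
  qed
  have fd: "f \<in> dual" if "f \<in> finite_dual" for f :: "'k gl \<Rightarrow> 'k"
    using that by (simp add: finite_dual_def)
  have L_fin: "?L f \<in> finite_dual" if f: "f \<in> finite_dual" for f
    unfolding L_eq[OF fd[OF f]]
    by (intro finite_dual_add finite_dual_gl_mult_right f finite_dual_scale gl_counit_finite_dual)
  have endo: "linear_endo_on finite_dual ?L"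
    using L_fin by (auto simp: linear_endo_on_def transpose_map_def fun_eq_iff)
  have "dual_comult (?L f) = dual_tensor (?L f) gl_counit +
      id_tensor finite_dual ?L (dual_comult f)" if f: "f \<in> finite_dual" for f
  proof -
    obtain n :: nat and F G where FG: "\<And>i. i < n \<Longrightarrow> F i \<in> finite_dual \<and> G i \<in> finite_dual"
      and fFG: "\<And>a b. f (gl_mult a b) = (\<Sum>i<n. F i a * G i b)"
      by (rule finite_dual_gl_mult_decomposition[OF f]) blast
    have "f (tree_mult s t) = (\<Sum>i<n. F i (basis s) * G i (basis t))" for s t
      using fFG[of "basis s" "basis t"] by simp
    then have cf: "dual_comult f = (\<Sum>i<n. dual_tensor (F i) (G i))"
      by (rule dual_comult_eq_sum_dual_tensor[OF fd[OF f]])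
    \<comment> \<open>\<open>id_tensor\<close> is independent of the decomposition, because the
      finite dual is a space of functionals preserved by \<open>?L\<close>; hence the one at hand
      may be used.\<close>
    have id: "id_tensor finite_dual ?L (dual_comult f) = (\<Sum>i<n. dual_tensor (F i) (?L (G i)))"
      unfolding cf
      by (rule id_tensor_sum[OF endo finite_dual_zero finite_dual_add finite_dual_scale _ FG])
        (auto intro: fd)
    \<comment> \<open>The summand \<open>M\<^sup>0 f \<otimes> \<epsilon>\<close> is appended as the term with index \<open>n\<close>.\<close>
    define F' G' where "F' = F(n := ?L f)" and "G' = (\<lambda>i. ?L (G i))(n := gl_counit)"
    have "?L f (tree_mult s t) = (\<Sum>i<Suc n. F' i (basis s) * G' i (basis t))" for s t
    proof -
      let ?s = "basis s :: 'k gl" and ?t = "basis t :: 'k gl"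
      have "(\<Sum>i<Suc n. F' i ?s * G' i ?t) =
          (\<Sum>i<n. F i ?s * ?L (G i) ?t) + ?L f ?s * gl_counit ?t"
        by (simp add: F'_def G'_def)
      \<comment> \<open>Expanding each \<open>?L (G i)\<close> on \<open>?t\<close> gives two sums,
        both of which match the decomposition of \<open>f\<close> on products.\<close>
      also have "(\<Sum>i<n. F i ?s * ?L (G i) ?t) =
          (\<Sum>i<n. F i ?s * G i (gl_mult ?t ?x)) - gl_counit ?t * (\<Sum>i<n. F i ?s * G i ?x)"
        unfolding sum_distrib_left sum_subtractf[symmetric]
        by (rule sum.cong) (use FG fd in \<open>auto simp: L_basis algebra_simps simp del: gl_mult_basis\<close>)
      also have "\<dots> = f (gl_mult ?s (gl_mult ?t ?x)) - gl_counit ?t * f (gl_mult ?s ?x)"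
        by (simp only: fFG)
      also have "gl_mult ?s (gl_mult ?t ?x) = gl_mult (gl_mult ?s ?t) ?x"
        by (simp add: tree_assoc_N_e)
      \<comment> \<open>Expanding \<open>?L f ?s * gl_counit ?t\<close> produces the same multiple
        of \<open>f (gl_mult ?s ?x)\<close> with opposite sign; what is left of it is the counit
        term of the product.\<close>
      finally have "(\<Sum>i<Suc n. F' i ?s * G' i ?t) =
          f (gl_mult (gl_mult ?s ?t) ?x) - gl_counit (gl_mult ?s ?t) * f ?x"
        by (simp add: L_basis[OF fd[OF f]] gl_counit_mult algebra_simps del: gl_mult_basis)
      also have "\<dots> = ?L f (gl_mult ?s ?t)" by (simp add: L_eq[OF fd[OF f]] del: gl_mult_basis)
      finally show ?thesis by simp
    qed
    then have "dual_comult (?L f) = (\<Sum>i<Suc n. dual_tensor (F' i) (G' i))"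
      by (rule dual_comult_eq_sum_dual_tensor[OF L_dual[OF fd[OF f]]])
    also have "\<dots> = (\<Sum>i<n. dual_tensor (F i) (?L (G i))) + dual_tensor (?L f) gl_counit"
      by (simp add: F'_def G'_def)
    finally show ?thesis by (simp add: id add.commute)
  qed
  then show ?thesis
    using L_fin endo by (auto simp: hochschild_solution_def)
qed

end
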